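(* Let $0<\alpha<1$, let $\lambda\in\mathbb{C}\setminus\{0\}$, let $\frac{\alpha\pi}{2}<\theta<\alpha\pi$, and let $\theta_0\in\left(0,\theta-\frac{\alpha\pi}{2}\right)$ satisfy $\big|\theta-|\arg(\lambda)|\big|\ge\theta_0$. Define $$m(\alpha,\lambda)=\max\left\{\frac{\int_{\gamma(1,\theta)}\left|\exp(\zeta^{\frac{1}{\alpha}})\right|\,|d\zeta|}{2\alpha\pi|\lambda|\sin\theta_0},\ \frac{\int_{\gamma(1,\theta)}\left|\exp(\zeta^{\frac{1}{\alpha}})\,\zeta^{\frac{1}{\alpha}}\right|\,|d\zeta|}{2\alpha|\lambda|^2\sin\theta_0}\right\},\qquad t_0=\frac{1}{|\lambda|^{\frac{1}{\alpha}}(1-\sin\theta_0)^{\frac{1}{\alpha}}}.$$ Then the following hold. (i) If $|\arg(\lambda)|<\frac{\alpha\pi}{2}$ and $t\ge t_0$, then $$\left|E_\alpha(\lambda t^{\alpha})-\frac{1}{\alpha}\exp\left(\lambda^{\frac{1}{\alpha}}t\right)\right|\le\frac{m(\alpha,\lambda)}{t^{\alpha}}.$$ (ii) If $|\arg(\lambda)|<\frac{\alpha\pi}{2}$ and $t\ge t_0$, then $$\left|t^{\alpha-1}E_{\alpha,\alpha}(\lambda t^{\alpha})-\frac{1}{\alpha}\lambda^{\frac{1}{\alpha}-1}\exp\left(\lambda^{\frac{1}{\alpha}}t\right)\right|\le\frac{m(\alpha,\lambda)}{t^{\alpha+1}}.$$ (iii) If $\theta<|\arg(\lambda)|\le\pi$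 and $t\ge t_0$, then $$\left|t^{\alpha-1}E_{\alpha,\alpha}(\lambda t^{\alpha})\right|\le\frac{m(\alpha,\lambda)}{t^{\alpha+1}}.$$
   Context: For $\alpha>0$ and $\beta\in\mathbb{C}$, the Mittag-Leffler function is $E_{\alpha,\beta}(z)=\sum_{k=0}^\infty\frac{z^k}{\Gamma(\alpha k+\beta)}$ for $z\in\mathbb{C}$ (with $1/\Gamma$ taken to be $0$ at the poles of $\Gamma$), and $E_\alpha:=E_{\alpha,1}$. The argument $\arg$ takes values in $(-\pi,\pi]$, and complex powers such as $\zeta^{1/\alpha}$, $\lambda^{1/\alpha}$ and $\lambda^{1/\alpha-1}$ are principal-branch powers. For $\varepsilon>0$ and $0<\theta\le\pi$, $\gamma(\varepsilon,\theta)$ denotes the contour in the complex plane consisting of three parts: the ray $\arg(z)=-\theta$, $|z|\ge\varepsilon$; the arc $-\theta\le\arg(z)\le\theta$, $|z|=\varepsilon$; and the ray $\arg(z)=\theta$, $|z|\ge\varepsilon$. The notation $|d\zeta|$ means integration with respect to arc length along the contour. *)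

theory Defs
  imports "HOL-Analysis.Analysis"
begin

text \<open>\<^const>\<open>rGamma\<close> is the entire function \<open>1/\<Gamma>\<close>, which vanishes at the poles of \<open>\<Gamma>\<close>.\<close>

definition mittag_leffler :: "real \<Rightarrow> complex \<Rightarrow> complex \<Rightarrow> complex" where
  "mittag_leffler \<alpha> \<beta> z = (\<Sum>k. z ^ k * rGamma (of_real (\<alpha> * real k) + \<beta>))"

text \<open>
  The contour \<open>\<gamma>(\<epsilon>,\<theta>)\<close>, parametrized by the whole real line: it comes in from infinity along
  the ray of argument \<open>-\<theta>\<close>, runs through the arc of radius \<open>\<epsilon>\<close> for \<open>s\<close> in \<open>[-\<theta>,\<theta>]\<close>, and leaves
  along the ray of argument \<open>\<theta>\<close>. For \<open>\<theta> = \<pi>\<close> both rays trace the negative real axis and each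
  counts separately, as the two edges of the cut.
\<close>

definition hankel_contour :: "real \<Rightarrow> real \<Rightarrow> real \<Rightarrow> complex" where
  "hankel_contour \<epsilon> \<theta> s =
     (if s < - \<theta> then of_real (\<epsilon> + (- \<theta> - s)) * cis (- \<theta>)
      else if s \<le> \<theta> then of_real \<epsilon> * cis s
      else of_real (\<epsilon> + (s - \<theta>)) * cis \<theta>)"

text \<open>
  The integral of \<open>f\<close> with respect to arc length, \<open>|d\<zeta>| = |\<gamma>'(s)| ds\<close>, along a piecewise
  differentiable curve on the real line. The value of \<^const>\<open>vector_derivative\<close> at the finitely
  many corners of the curve is irrelevant.
\<close>

definition arc_length_integral :: "(real \<Rightarrow> complex) \<Rightarrow> (complex \<Rightarrow> real) \<Rightarrow> real" where
  "arc_length_integral \<gamma> f =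
     (LINT s|lborel. f (\<gamma> s) * norm (vector_derivative \<gamma> (at s)))"

end

theory Submission
  imports Defs "HOL-Complex_Analysis.Residue_Theorem" "HOL-Real_Asymp.Real_Asymp"
begin

text \<open>
  Put \<open>\<kappa> = 1/\<alpha>\<close>. The substitution \<open>\<zeta> = e\<^sup>w\<close> straightens the contour \<open>\<gamma>(e\<^sup>c,\<theta>)\<close> into two horizontal
  half-lines and a vertical segment and removes the branch cut: the integrand
  \<open>exp(\<zeta>\<^sup>\<kappa>) \<zeta>\<^sup>b/(\<zeta> - z) d\<zeta>\<close> becomes the meromorphic \<open>exp(e\<^bsup>\<kappa>w\<^esup>) e\<^bsup>bw\<^esup> e\<^sup>w/(e\<^sup>w - z) dw\<close>, so that every
  deformation is an application of Cauchy's theorem to rectangles.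

  Hankel's formula for \<open>1/\<Gamma>\<close> is obtained by opening the angle to \<open>\<alpha>\<pi>\<close> and letting
  \<open>c \<rightarrow> -\<infinity>\<close>, where the two half-lines combine to a multiple of Euler's integral; the exponents for
  which this integral diverges are reached through the functional equation. Expanding
  \<open>1/(\<zeta> - z)\<close> in a geometric series represents \<open>E\<^sub>\<alpha>\<^sub>,\<^sub>\<beta>(z)\<close> by an integral over a contour of radius
  larger than \<open>|z|\<close>, and shrinking the radius to \<open>1\<close> picks up the residue at \<open>w = Ln z\<close>, which is the
  exponential term, exactly if \<open>|arg z| < \<theta>\<close>. Finally \<open>|\<zeta> - z| \<ge> |z| sin \<theta>\<^sub>0\<close> on \<open>\<gamma>(1,\<theta>)\<close>.
  For \<open>\<beta> = \<alpha>\<close> one first writes \<open>1/(\<zeta> - z) = -1/z + \<zeta>/(z(\<zeta> - z))\<close>; the first term integrates to a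
  multiple of \<open>1/\<Gamma>(0) = 0\<close>, which gains one power of \<open>1/z\<close>.
\<close>

subsection \<open>Integrals over rectangles and half-lines\<close>

lemma contour_integral_linepath_same_Im:
  assumes "a < b"
  shows "contour_integral (linepath (Complex a c) (Complex b c)) f = integral {a..b} (\<lambda>x. f (Complex x c))"
proof -
  have "contour_integral (linepath (Complex a c) (Complex b c)) f
      = contour_integral (linepath (of_real a) (of_real b)) (\<lambda>z. f (z + \<i> * of_real c))"
    by (simp add: contour_integral_integral linepath_def Complex_eq scaleR_conv_of_real algebra_simps)
  also have "\<dots> = integral {a..b} (\<lambda>x. f (of_real x + \<i> * of_real c))"
    using assms by (subst contour_integral_linepath_Reals_eq) auto
  finally show ?thesis by (simp add: Complex_eq)
qed

lemma contour_integral_rectpath: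
  assumes "a < b" "p < q" and f: "continuous_on (path_image (rectpath (Complex a p) (Complex b q))) f"
  shows "contour_integral (rectpath (Complex a p) (Complex b q)) f =
    integral {a..b} (\<lambda>x. f (Complex x p)) + \<i> * integral {p..q} (\<lambda>y. f (Complex b y))
    - integral {a..b} (\<lambda>x. f (Complex x q)) - \<i> * integral {p..q} (\<lambda>y. f (Complex a y))"
proof -
  note pi = rectpath_def Let_def path_image_join
  have c1: "continuous_on (closed_segment (Complex a p) (Complex b p)) f"
    and c2: "continuous_on (closed_segment (Complex b p) (Complex b q)) f"
    and c3: "continuous_on (closed_segment (Complex b q) (Complex a q)) f"
    and c4: "continuous_on (closed_segment (Complex a q) (Complex a p)) f"
    by (auto intro!: continuous_on_subset[OF f] simp: pi)
  note c = this[THEN contour_integrable_continuous_linepath]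
  have "contour_integral (rectpath (Complex a p) (Complex b q)) f =
     contour_integral (linepath (Complex a p) (Complex b p)) f
   + (contour_integral (linepath (Complex b p) (Complex b q)) f
   + (contour_integral (linepath (Complex b q) (Complex a q)) f
   + contour_integral (linepath (Complex a q) (Complex a p)) f))"
    unfolding rectpath_def Let_def using c
    by (simp add: contour_integrable_joinI valid_path_join)
  also have "contour_integral (linepath (Complex b q) (Complex a q)) f
     = - contour_integral (linepath (Complex a q) (Complex b q)) f"
    by (rule contour_integral_reverse_linepath[OF c3])
  also have "contour_integral (linepath (Complex a q) (Complex a p)) f
     = - contour_integral (linepath (Complex a p) (Complex a q)) f"
    by (rule contour_integral_reverse_linepath[OF c4])
  finally show ?thesis
    using assms(1,2) by (simp add: contour_integral_linepath_same_Im contour_integral_linepath_same_Re)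
qed

text \<open>The boundary integral is spelled out as four real integrals, since truncating a
  \<open>hankel_integral\<close> leaves exactly these sides.\<close>

lemma rectangle_integral_eq_0:
  assumes "a < b" "p < q" "f holomorphic_on S" "convex S" "open S"
    "cbox (Complex a p) (Complex b q) \<subseteq> S"
  shows "integral {a..b} (\<lambda>x. f (Complex x p)) + \<i> * integral {p..q} (\<lambda>y. f (Complex b y))
    - integral {a..b} (\<lambda>x. f (Complex x q)) - \<i> * integral {p..q} (\<lambda>y. f (Complex a y)) = 0"
proof -
  have sub: "path_image (rectpath (Complex a p) (Complex b q)) \<subseteq> S"
    using path_image_rectpath_subset_cbox[of "Complex a p" "Complex b q"] assms by auto
  have "(f has_contour_integral 0) (rectpath (Complex a p) (Complex b q))"
    by (rule Cauchy_theorem_convex_simple[OF assms(3,4)]) (use sub in auto)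
  moreover have "continuous_on (path_image (rectpath (Complex a p) (Complex b q))) f"
    using holomorphic_on_imp_continuous_on[OF assms(3)] sub by (rule continuous_on_subset)
  ultimately show ?thesis
    using contour_integral_rectpath[OF assms(1,2), of f] contour_integral_unique[of f 0] by simp
qed

text \<open>A single singularity suffices: the integrand used later has its poles at the logarithms
  of z, and at most one of them lies in the strip |Im w| < \<pi>.\<close>

lemma rectangle_integral_residue:
  assumes "a < b" "p < q" "f holomorphic_on S - {z}" "convex S" "open S"
    "cbox (Complex a p) (Complex b q) \<subseteq> S" "z \<in> box (Complex a p) (Complex b q)"
  shows "integral {a..b} (\<lambda>x. f (Complex x p)) + \<i> * integral {p..q} (\<lambda>y. f (Complex b y))
    - integral {a..b} (\<lambda>x. f (Complex x q)) - \<i> * integral {p..q} (\<lambda>y. f (Complex a y))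
     = 2 * pi * \<i> * residue f z"
proof -
  have sub: "path_image (rectpath (Complex a p) (Complex b q)) \<subseteq> S - {z}"
    using path_image_rectpath_subset_cbox[of "Complex a p" "Complex b q"]
      path_image_rectpath_inter_box[of "Complex a p" "Complex b q"] assms by auto
  have "contour_integral (rectpath (Complex a p) (Complex b q)) f =
      2 * pi * \<i> * (\<Sum>x\<in>{z}. winding_number (rectpath (Complex a p) (Complex b q)) x * residue f x)"
  proof (rule Residue_theorem)
    show "\<forall>z. z \<notin> S \<longrightarrow> winding_number (rectpath (Complex a p) (Complex b q)) z = 0"
      using assms by (intro allI impI winding_number_rectpath_outside) auto
  qed (use assms sub convex_connected in auto)
  also have "winding_number (rectpath (Complex a p) (Complex b q)) z = 1"
    using assms by (intro winding_number_rectpath) auto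
  moreover have "continuous_on (path_image (rectpath (Complex a p) (Complex b q))) f"
    using holomorphic_on_imp_continuous_on[OF assms(3)] sub by (rule continuous_on_subset)
  ultimately show ?thesis
    using contour_integral_rectpath[OF assms(1,2)] by simp
qed

section \<open>Half-lines and integrands of exponential decay\<close>

lemma integral_atLeast_split:
  fixes f :: "real \<Rightarrow> 'a::banach"
  assumes "f integrable_on {c..}" "c \<le> d"
  shows "integral {c..} f = integral {c..d} f + integral {d..} f" "f integrable_on {d..}"
proof -
  have i1: "f integrable_on {c..d}"
    by (rule integrable_on_subinterval[OF assms(1)]) auto
  \<comment> \<open>Removing the closed interval leaves the open half-line; its endpoint is then
    restored as a null set.\<close>
  have "f integrable_on {c..} - {c..d}"
    by (rule integrable_setdiff[OF integrable_integral[OF assms(1)] integrable_integral[OF i1]])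
       (use assms in auto)
  moreover have "{c..} - {c..d} = {d<..}" using assms by auto
  ultimately have "f integrable_on {d<..}" by simp
  moreover have "{d..} - {d<..} = {d}" "{d<..} - {d..} = {}" by auto
  ultimately show i2: "f integrable_on {d..}"
    by (subst integrable_spike_set_eq[of _ "{d<..}"]) auto
  have "{c..d} \<inter> {d..} = {d}" "{c..d} \<union> {d..} = {c..}" using assms by auto
  thus "integral {c..} f = integral {c..d} f + integral {d..} f"
    using integral_Un[OF i1 i2] by simp
qed

lemma absolutely_integrable_exp_bound:
  fixes f :: "real \<Rightarrow> 'a::euclidean_space"
  assumes "continuous_on {c..} f" "\<And>x. x \<ge> c \<Longrightarrow> norm (f x) \<le> A * exp (- x)"
  shows "f absolutely_integrable_on {c..}"
proof (rule measurable_bounded_by_integrable_imp_absolutely_integrable)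
  show "f \<in> borel_measurable (lebesgue_on {c..})"
    by (rule continuous_imp_measurable_on_sets_lebesgue[OF assms(1)]) auto
  show "(\<lambda>x. A * exp (- x)) integrable_on {c..}"
    using integrable_on_exp_minus_to_infinity[of 1 c] by (intro integrable_on_mult_right) auto
qed (use assms in auto)

text \<open>The double exponential beats exp(a x) for a of either sign, so a majorant of the one
  form \<open>A * exp (- x)\<close> serves all exponents. Beyond some X the product with exp x is
  below 1, and on the compact rest it is bounded by continuity.\<close>

lemma double_exp_decay:
  fixes \<delta> \<kappa> a c :: real
  assumes "\<delta> > 0" "\<kappa> > 0"
  obtains A where "A > 0" "\<And>x. x \<ge> c \<Longrightarrow> exp (- \<delta> * exp (\<kappa> * x)) * exp (a * x) \<le> A * exp (- x)"
proof -
  define f where "f = (\<lambda>x::real. exp (- \<delta> * exp (\<kappa> * x)) * exp (a * x) * exp x)"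
  have "(f \<longlongrightarrow> 0) at_top"
    unfolding f_def using assms by real_asymp
  hence "eventually (\<lambda>x. f x < 1) at_top"
    by (rule order_tendstoD) simp
  then obtain X where X: "\<And>x. x \<ge> X \<Longrightarrow> f x < 1"
    unfolding eventually_at_top_linorder by blast
  have "continuous_on {c..max c X} f"
    unfolding f_def by (intro continuous_intros)
  then obtain B where B: "\<And>x. x \<in> {c..max c X} \<Longrightarrow> norm (f x) \<le> B"
    using compact_imp_bounded[OF compact_continuous_image[of "{c..max c X}" f]]
    unfolding bounded_iff by (meson compact_Icc imageI)
  have "f x \<le> max B 1" if "x \<ge> c" for x
  proof (cases "x \<le> max c X")
    case True
    thus ?thesis using B[of x] that by auto
  next
    case False
    thus ?thesis using X[of x] by (simp add: less_imp_le)
  qed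
  note f_le = this
  have "u \<le> M * exp (- x)" if "u * exp x \<le> M" for u M x :: real
    using that by (simp add: exp_minus field_simps)
  from this[OF f_le[unfolded f_def]] show ?thesis
    using that[of "max B 1"] by auto
qed

lemma norm_integral_exp_bound:
  fixes f :: "real \<Rightarrow> 'a::euclidean_space"
  assumes "continuous_on {c..} f" "\<And>x. x \<ge> c \<Longrightarrow> norm (f x) \<le> A * exp (- x)"
  shows "norm (integral {c..} f) \<le> A * exp (- c)"
proof -
  have "((\<lambda>x. A * exp (- x)) has_integral A * exp (- c)) {c..}"
    using has_integral_mult_right[OF has_integral_exp_minus_to_infinity[of 1 c], of A] by simp
  thus ?thesis
    by (rule integral_norm_bound_integral'[rotated -1])
       (use assms in \<open>auto intro: continuous_imp_measurable_on_sets_lebesgue\<close>)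
qed

text \<open>This is how the far side of a rectangle is discarded: the quantity of interest does not
  depend on the cut-off d, while its bound decays in d.\<close>

lemma eq_0_if_norm_le_exp:
  fixes z :: "'a::real_normed_vector"
  assumes "\<And>d. d > c \<Longrightarrow> norm z \<le> A * exp (- d)"
  shows "z = 0"
proof -
  have "((\<lambda>d::real. A * exp (- d)) \<longlongrightarrow> 0) at_top" by real_asymp
  hence "norm z \<le> 0"
    by (rule tendsto_lowerbound) (auto intro!: eventually_mono[OF eventually_gt_at_top[of c]] assms)
  thus ?thesis by simp
qed

lemma norm_add_le: "norm x \<le> a \<Longrightarrow> norm y \<le> b \<Longrightarrow> norm (x + y) \<le> a + b"
  using norm_triangle_ineq[of x y] by linarith

lemma norm_diff_le: "norm x \<le> a \<Longrightarrow> norm y \<le> b \<Longrightarrow> norm (x - y) \<le> a + b"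
  using norm_triangle_ineq4[of x y] by linarith

subsection \<open>Integrals over the logarithmic contour\<close>

text \<open>
  The image of the contour of radius \<open>e\<^sup>c\<close> under the logarithm. The lower half-line is traversed from
  infinity, hence the minus sign in \<open>hankel_integral\<close>.
\<close>

definition log_contour :: "real \<Rightarrow> real \<Rightarrow> complex set" where
  "log_contour c \<theta> = {w. Re w = c \<and> \<bar>Im w\<bar> \<le> \<theta>} \<union> {w. Re w \<ge> c \<and> \<bar>Im w\<bar> = \<theta>}"

lemma in_log_contour:
  "\<theta> \<ge> 0 \<Longrightarrow> x \<ge> c \<Longrightarrow> Complex x \<theta> \<in> log_contour c \<theta>"
  "\<theta> \<ge> 0 \<Longrightarrow> x \<ge> c \<Longrightarrow> Complex x (- \<theta>) \<in> log_contour c \<theta>"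
  "- \<theta> \<le> y \<Longrightarrow> y \<le> \<theta> \<Longrightarrow> Complex c y \<in> log_contour c \<theta>"
  by (auto simp: log_contour_def)

text \<open>Absolute integrability is demanded because the change of variables on the rays works
  with it. The codomain is generic so that real majorants are covered as well.\<close>

definition hankel_integrable :: "real \<Rightarrow> real \<Rightarrow> (complex \<Rightarrow> 'a::euclidean_space) \<Rightarrow> bool" where
  "hankel_integrable c \<theta> G \<longleftrightarrow>
     (\<lambda>x. G (Complex x \<theta>)) absolutely_integrable_on {c..} \<and>
     (\<lambda>x. G (Complex x (- \<theta>))) absolutely_integrable_on {c..} \<and>
     (\<lambda>y. G (Complex c y)) absolutely_integrable_on {- \<theta>..\<theta>}"

definition hankel_integral :: "real \<Rightarrow> real \<Rightarrow> (complex \<Rightarrow> complex) \<Rightarrow> complex" where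
  "hankel_integral c \<theta> G =
     integral {c..} (\<lambda>x. G (Complex x \<theta>)) - integral {c..} (\<lambda>x. G (Complex x (- \<theta>)))
     + \<i> * integral {- \<theta>..\<theta>} (\<lambda>y. G (Complex c y))"

text \<open>The integral of g against |dw|, so the incoming ray counts positively. As \<zeta> = exp
  w gives |d\<zeta>| = |exp w| |dw|, arc length integrals over the original contour appear here with
  an extra factor \<open>norm (exp w)\<close>.\<close>

definition hankel_length_integral :: "real \<Rightarrow> real \<Rightarrow> (complex \<Rightarrow> real) \<Rightarrow> real" where
  "hankel_length_integral c \<theta> g =
     integral {c..} (\<lambda>x. g (Complex x \<theta>)) + integral {c..} (\<lambda>x. g (Complex x (- \<theta>)))
     + integral {- \<theta>..\<theta>} (\<lambda>y. g (Complex c y))"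

lemma continuous_on_Complex [continuous_intros]:
  "continuous_on S f \<Longrightarrow> continuous_on S g \<Longrightarrow> continuous_on S (\<lambda>x. Complex (f x) (g x))"
  unfolding Complex_eq by (intro continuous_intros)

lemma continuous_on_compose_Complex:
  assumes "continuous_on T G" "continuous_on S f" "continuous_on S g"
    "\<And>x. x \<in> S \<Longrightarrow> Complex (f x) (g x) \<in> T"
  shows "continuous_on S (\<lambda>x. G (Complex (f x) (g x)))"
  by (rule continuous_on_compose2[OF assms(1)]) (use assms in \<open>auto intro!: continuous_intros\<close>)

lemma hankel_integrableI:
  assumes "continuous_on (log_contour c \<theta>) G" "\<theta> \<ge> 0"
    "\<And>w. w \<in> log_contour c \<theta> \<Longrightarrow> norm (G w) \<le> A * exp (- Re w)"
  shows "hankel_integrable c \<theta> G"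
  unfolding hankel_integrable_def
proof (intro conjI)
  show "(\<lambda>x. G (Complex x \<theta>)) absolutely_integrable_on {c..}"
    "(\<lambda>x. G (Complex x (- \<theta>))) absolutely_integrable_on {c..}"
    using assms(2) assms(3)[OF in_log_contour(1)] assms(3)[OF in_log_contour(2)]
    by (auto intro!: absolutely_integrable_exp_bound[where A = A] in_log_contour
        continuous_on_compose_Complex[OF assms(1)] continuous_intros)
  show "(\<lambda>y. G (Complex c y)) absolutely_integrable_on {- \<theta>..\<theta>}"
    by (intro absolutely_integrable_continuous_real continuous_on_compose_Complex[OF assms(1)]
        continuous_intros) (auto simp: log_contour_def)
qed

lemma hankel_integrable_integrable_on:
  assumes "hankel_integrable c \<theta> G"
  shows "(\<lambda>x. G (Complex x \<theta>)) integrable_on {c..}"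
    "(\<lambda>x. G (Complex x (- \<theta>))) integrable_on {c..}"
    "(\<lambda>y. G (Complex c y)) integrable_on {- \<theta>..\<theta>}"
  using assms unfolding hankel_integrable_def by (auto dest: absolutely_integrable_on_def[THEN iffD1])

lemma hankel_integrable_add:
  assumes "hankel_integrable c \<theta> F" "hankel_integrable c \<theta> G"
  shows "hankel_integrable c \<theta> (\<lambda>w. F w + G w)"
  using assms unfolding hankel_integrable_def by (auto intro: set_integral_add)

lemma hankel_integrable_cmult:
  fixes F :: "complex \<Rightarrow> complex"
  assumes "hankel_integrable c \<theta> F"
  shows "hankel_integrable c \<theta> (\<lambda>w. k * F w)"
  using assms unfolding hankel_integrable_def by auto

lemma hankel_integral_add:
  assumes "hankel_integrable c \<theta> F" "hankel_integrable c \<theta> G"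
  shows "hankel_integral c \<theta> (\<lambda>w. F w + G w) = hankel_integral c \<theta> F + hankel_integral c \<theta> G"
  using assms[THEN hankel_integrable_integrable_on(1)] assms[THEN hankel_integrable_integrable_on(2)]
    assms[THEN hankel_integrable_integrable_on(3)]
  by (simp add: hankel_integral_def integral_add algebra_simps)

lemma hankel_integral_cmult:
  "hankel_integral c \<theta> (\<lambda>w. k * F w) = k * hankel_integral c \<theta> F"
  by (simp add: hankel_integral_def algebra_simps)

lemma hankel_integral_norm_le:
  assumes "hankel_integrable c \<theta> G" "hankel_integrable c \<theta> g" "\<theta> \<ge> 0"
    "\<And>w. w \<in> log_contour c \<theta> \<Longrightarrow> norm (G w) \<le> g w"
  shows "norm (hankel_integral c \<theta> G) \<le> hankel_length_integral c \<theta> g"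
proof -
  note G = hankel_integrable_integrable_on[OF assms(1)]
  note g = hankel_integrable_integrable_on[OF assms(2)]
  have "norm (integral {c..} (\<lambda>x. G (Complex x \<theta>))) \<le> integral {c..} (\<lambda>x. g (Complex x \<theta>))"
    by (rule integral_norm_bound_integral[OF G(1) g(1)])
       (use assms in \<open>auto intro!: assms(4) in_log_contour\<close>)
  moreover have "norm (integral {c..} (\<lambda>x. G (Complex x (- \<theta>)))) \<le> integral {c..} (\<lambda>x. g (Complex x (- \<theta>)))"
    by (rule integral_norm_bound_integral[OF G(2) g(2)])
       (use assms in \<open>auto intro!: assms(4) in_log_contour\<close>)
  moreover have "norm (\<i> * integral {- \<theta>..\<theta>} (\<lambda>y. G (Complex c y))) \<le> integral {- \<theta>..\<theta>} (\<lambda>y. g (Complex c y))"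
    unfolding norm_mult norm_ii mult_1
    by (rule integral_norm_bound_integral[OF G(3) g(3)])
       (use assms in \<open>auto intro!: assms(4) in_log_contour\<close>)
  ultimately show ?thesis
    unfolding hankel_integral_def hankel_length_integral_def
    by (smt (verit) norm_triangle_ineq norm_triangle_ineq4)
qed

lemma hankel_integral_cong:
  assumes "\<theta> \<ge> 0" "\<And>w. w \<in> log_contour c \<theta> \<Longrightarrow> F w = G w"
  shows "hankel_integral c \<theta> F = hankel_integral c \<theta> G"
  unfolding hankel_integral_def
  using assms(1) by (intro arg_cong2[of _ _ _ _ "(+)"] arg_cong2[of _ _ _ _ "(-)"] arg_cong2[of _ _ _ _ "(*)"]
      refl Henstock_Kurzweil_Integration.integral_cong assms(2) in_log_contour) auto

lemma hankel_length_integral_cong: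
  assumes "\<theta> \<ge> 0" "\<And>w. w \<in> log_contour c \<theta> \<Longrightarrow> F w = G w"
  shows "hankel_length_integral c \<theta> F = hankel_length_integral c \<theta> G"
  unfolding hankel_length_integral_def
  using assms(1) by (intro arg_cong2[of _ _ _ _ "(+)"]
      Henstock_Kurzweil_Integration.integral_cong assms(2) in_log_contour) auto

lemma hankel_integrable_cong:
  assumes "\<theta> \<ge> 0" "\<And>w. w \<in> log_contour c \<theta> \<Longrightarrow> F w = G w"
  shows "hankel_integrable c \<theta> F \<longleftrightarrow> hankel_integrable c \<theta> G"
  unfolding hankel_integrable_def
  using assms(1) by (intro arg_cong2[of _ _ _ _ "(\<and>)"] set_integrable_cong refl assms(2) in_log_contour) auto

lemma hankel_length_integral_cmult:
  "hankel_length_integral c \<theta> (\<lambda>w. k * g w) = k * hankel_length_integral c \<theta> g"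
  by (simp add: hankel_length_integral_def algebra_simps)

lemma hankel_integrable_sum:
  assumes "finite I" "\<And>i. i \<in> I \<Longrightarrow> hankel_integrable c \<theta> (F i :: complex \<Rightarrow> complex)"
  shows "hankel_integrable c \<theta> (\<lambda>w. \<Sum>i\<in>I. F i w)"
    and "hankel_integral c \<theta> (\<lambda>w. \<Sum>i\<in>I. F i w) = (\<Sum>i\<in>I. hankel_integral c \<theta> (F i))"
proof -
  have "hankel_integrable c \<theta> (\<lambda>w. \<Sum>i\<in>I. F i w) \<and>
    hankel_integral c \<theta> (\<lambda>w. \<Sum>i\<in>I. F i w) = (\<Sum>i\<in>I. hankel_integral c \<theta> (F i))"
    using assms
  proof (induction I rule: finite_induct)
    case empty
    show ?case by (simp add: hankel_integrable_def hankel_integral_def)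
  next
    case (insert i I)
    thus ?case by (simp add: hankel_integrable_add hankel_integral_add)
  qed
  thus "hankel_integrable c \<theta> (\<lambda>w. \<Sum>i\<in>I. F i w)"
    "hankel_integral c \<theta> (\<lambda>w. \<Sum>i\<in>I. F i w) = (\<Sum>i\<in>I. hankel_integral c \<theta> (F i))"
    by auto
qed

text \<open>The tails beyond d cancel. What remains is the boundary of the rectangle [c,d] x
  [-\<theta>,\<theta>], traversed counterclockwise, so the two rectangle lemmas apply
  directly.\<close>

lemma hankel_integral_shift:
  assumes "hankel_integrable c \<theta> G" "c < d"
  shows "hankel_integral d \<theta> G - hankel_integral c \<theta> G =
    integral {c..d} (\<lambda>x. G (Complex x (- \<theta>))) + \<i> * integral {- \<theta>..\<theta>} (\<lambda>y. G (Complex d y))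
    - integral {c..d} (\<lambda>x. G (Complex x \<theta>)) - \<i> * integral {- \<theta>..\<theta>} (\<lambda>y. G (Complex c y))"
  using assms(2)
  by (simp add: hankel_integral_def algebra_simps
      integral_atLeast_split(1)[OF hankel_integrable_integrable_on(1)[OF assms(1)], of d]
      integral_atLeast_split(1)[OF hankel_integrable_integrable_on(2)[OF assms(1)], of d])

lemma hankel_integral_shift_eq:
  assumes "hankel_integrable c \<theta> G" "c \<le> d" "\<theta> > 0" "G holomorphic_on UNIV"
  shows "hankel_integral d \<theta> G = hankel_integral c \<theta> G"
proof (cases "c < d")
  case True
  thus ?thesis
    using rectangle_integral_eq_0[OF True _ assms(4), of "- \<theta>" \<theta>]
      hankel_integral_shift[OF assms(1) True] assms(3) by simp
qed (use assms in auto)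

subsection \<open>Hankel's formula\<close>

text \<open>With \<zeta> = exp w and dw = d\<zeta>/\<zeta> this is exp(\<zeta>^\<kappa>)
  \<zeta>^(a-1) d\<zeta>. In terms of u = \<zeta>^\<kappa> it becomes e^u u^(a/\<kappa> - 1) du, up
  to the factor 1/\<kappa>, which is Hankel's integrand for 1/\<Gamma>(1 - a/\<kappa>).\<close>

definition hankel_kernel :: "real \<Rightarrow> real \<Rightarrow> complex \<Rightarrow> complex" where
  "hankel_kernel \<kappa> a w = exp (exp (of_real \<kappa> * w)) * exp (of_real a * w)"

lemma holomorphic_hankel_kernel [holomorphic_intros]:
  "f holomorphic_on S \<Longrightarrow> (\<lambda>w. hankel_kernel \<kappa> a (f w)) holomorphic_on S"
  unfolding hankel_kernel_def by (intro holomorphic_intros)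

lemma continuous_hankel_kernel [continuous_intros]:
  "continuous_on S f \<Longrightarrow> continuous_on S (\<lambda>w. hankel_kernel \<kappa> a (f w))"
  unfolding hankel_kernel_def by (intro continuous_intros)

text \<open>The derivative is again a combination of kernels, which yields a recursion in a once its
  integral over the contour is seen to vanish.\<close>

lemma hankel_kernel_DERIV:
  "(hankel_kernel \<kappa> a has_field_derivative
     (of_real \<kappa> * hankel_kernel \<kappa> (a + \<kappa>) w + of_real a * hankel_kernel \<kappa> a w)) (at w)"
  unfolding hankel_kernel_def
  by (rule derivative_eq_intros refl | simp add: algebra_simps exp_add)+

lemma norm_hankel_kernel:
  "norm (hankel_kernel \<kappa> a w) = exp (exp (\<kappa> * Re w) * cos (\<kappa> * Im w)) * exp (a * Re w)"
  by (simp add: hankel_kernel_def norm_mult Re_exp)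

text \<open>Where cos(\<kappa> Im w) \<le> -\<delta>, the modulus is at most exp(-\<delta>
  exp(\<kappa> Re w)) exp(a Re w). The constant A does not depend on Im w, which is what allows
  whole strips to be swept by the rays.\<close>

lemma hankel_kernel_decay:
  assumes "\<kappa> > 0" "\<delta> > 0"
  obtains A where "A > 0"
    "\<And>w. Re w \<ge> c \<Longrightarrow> cos (\<kappa> * Im w) \<le> - \<delta> \<Longrightarrow> norm (hankel_kernel \<kappa> a w) \<le> A * exp (- Re w)"
proof -
  obtain A where A: "A > 0" "\<And>x. x \<ge> c \<Longrightarrow> exp (- \<delta> * exp (\<kappa> * x)) * exp (a * x) \<le> A * exp (- x)"
    using double_exp_decay[OF assms(2,1)] by blast
  have "norm (hankel_kernel \<kappa> a w) \<le> A * exp (- Re w)" if "Re w \<ge> c" "cos (\<kappa> * Im w) \<le> - \<delta>" for w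
  proof -
    have "exp (\<kappa> * Re w) * cos (\<kappa> * Im w) \<le> exp (\<kappa> * Re w) * (- \<delta>)"
      using that by (intro mult_left_mono) auto
    hence "norm (hankel_kernel \<kappa> a w) \<le> exp (- \<delta> * exp (\<kappa> * Re w)) * exp (a * Re w)"
      unfolding norm_hankel_kernel by (intro mult_right_mono) (auto simp: mult_ac)
    also have "\<dots> \<le> A * exp (- Re w)" using A(2) that by auto
    finally show ?thesis .
  qed
  with A(1) that show ?thesis by blast
qed

lemma cos_le_cos_angle:
  assumes "pi / 2 < \<phi>" "\<phi> \<le> pi" "\<phi> \<le> \<bar>x\<bar>" "\<bar>x\<bar> \<le> pi"
  shows "cos x \<le> cos \<phi>" "cos \<phi> < 0"
proof -
  have "cos \<bar>x\<bar> \<le> cos \<phi>" using assms by (intro cos_monotone_0_pi_le) auto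
  thus "cos x \<le> cos \<phi>" by (simp add: abs_if split: if_splits)
  show "cos \<phi> < 0" using assms cos_lt_zero_pi[of \<phi>] by auto
qed

lemma hankel_kernel_log_contour_decay:
  assumes "\<kappa> > 0" "pi / 2 < \<kappa> * \<theta>" "\<kappa> * \<theta> \<le> pi"
  obtains A where "A > 0"
    "\<And>w. w \<in> log_contour c \<theta> \<Longrightarrow> norm (hankel_kernel \<kappa> a w) \<le> A * exp (- Re w)"
proof -
  obtain A where A: "A > 0" "\<And>w. Re w \<ge> c \<Longrightarrow> cos (\<kappa> * Im w) \<le> - (- cos (\<kappa> * \<theta>)) \<Longrightarrow>
       norm (hankel_kernel \<kappa> a w) \<le> A * exp (- Re w)"
    using hankel_kernel_decay[of \<kappa> "- cos (\<kappa> * \<theta>)" c a] cos_le_cos_angle(2)[of "\<kappa> * \<theta>" "\<kappa> * \<theta>"] assms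
    by (metis abs_of_pos assms(1) neg_0_less_iff_less order.refl order_less_trans pi_half_gt_zero)
  \<comment> \<open>On the vertical segment the sign of the cosine varies, so only cos \<le> 1 is
    used; B is the resulting bound times exp c.\<close>
  define B where "B = exp (exp (\<kappa> * c)) * exp (a * c) * exp c"
  have "norm (hankel_kernel \<kappa> a w) \<le> max A B * exp (- Re w)" if w: "w \<in> log_contour c \<theta>" for w
  proof (cases "Re w = c")
    case True
    have "exp (\<kappa> * c) * cos (\<kappa> * Im w) \<le> exp (\<kappa> * c) * 1"
      by (intro mult_left_mono) auto
    hence "norm (hankel_kernel \<kappa> a w) \<le> exp (exp (\<kappa> * c)) * exp (a * c)"
      unfolding norm_hankel_kernel True by (intro mult_right_mono) auto
    also have "\<dots> = B * exp (- Re w)" by (simp add: B_def True exp_minus)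
    also have "\<dots> \<le> max A B * exp (- Re w)" by (intro mult_right_mono) auto
    finally show ?thesis .
  next
    case False
    hence "Im w = \<theta> \<or> Im w = - \<theta>" "Re w \<ge> c" using w by (auto simp: log_contour_def)
    hence "norm (hankel_kernel \<kappa> a w) \<le> A * exp (- Re w)"
      by (intro A(2)) auto
    also have "\<dots> \<le> max A B * exp (- Re w)" by (intro mult_right_mono) auto
    finally show ?thesis .
  qed
  thus ?thesis using that[of "max A B"] A(1) by auto
qed

lemma hankel_integrable_kernel_bounded:
  assumes "\<kappa> > 0" "pi / 2 < \<kappa> * \<theta>" "\<kappa> * \<theta> \<le> pi" "continuous_on (log_contour c \<theta>) F"
    "\<And>w. w \<in> log_contour c \<theta> \<Longrightarrow> norm (F w) \<le> C * norm (hankel_kernel \<kappa> a w)" "C \<ge> 0"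
  shows "hankel_integrable c \<theta> F"
proof -
  obtain A where A: "A > 0"
    "\<And>w. w \<in> log_contour c \<theta> \<Longrightarrow> norm (hankel_kernel \<kappa> a w) \<le> A * exp (- Re w)"
    using hankel_kernel_log_contour_decay assms by blast
  show ?thesis
  proof (rule hankel_integrableI[OF assms(4), where A = "C * A"])
    have "0 < \<kappa> * \<theta>" using assms pi_half_gt_zero by linarith
    thus "\<theta> \<ge> 0" using assms(1) by (simp add: zero_less_mult_iff)
  next
    fix w assume w: "w \<in> log_contour c \<theta>"
    have "norm (F w) \<le> C * norm (hankel_kernel \<kappa> a w)" using assms(5) w by auto
    also have "\<dots> \<le> C * (A * exp (- Re w))" using A w assms(6) by (intro mult_left_mono) auto
    finally show "norm (F w) \<le> C * A * exp (- Re w)" by (simp add: mult_ac)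
  qed
qed

lemma hankel_integrable_kernel:
  assumes "\<kappa> > 0" "pi / 2 < \<kappa> * \<theta>" "\<kappa> * \<theta> \<le> pi"
  shows "hankel_integrable c \<theta> (hankel_kernel \<kappa> a)"
  by (rule hankel_integrable_kernel_bounded[OF assms, where C = 1 and a = a])
     (auto intro!: continuous_intros)

section \<open>Rotating the rays\<close>

lemma hankel_kernel_shift_angle:
  assumes "\<kappa> > 0" "\<delta> > 0" "p < q" "\<And>y. y \<in> {p..q} \<Longrightarrow> cos (\<kappa> * y) \<le> - \<delta>"
  shows "integral {c..} (\<lambda>x. hankel_kernel \<kappa> a (Complex x p)) - integral {c..} (\<lambda>x. hankel_kernel \<kappa> a (Complex x q))
    = \<i> * integral {p..q} (\<lambda>y. hankel_kernel \<kappa> a (Complex c y))"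
proof -
  let ?K = "hankel_kernel \<kappa> a"
  let ?I = "\<lambda>c y. integral {c..} (\<lambda>x. ?K (Complex x y))"
  let ?J = "\<lambda>c. \<i> * integral {p..q} (\<lambda>y. ?K (Complex c y))"
  obtain A where A: "A > 0" "\<And>w. Re w \<ge> c \<Longrightarrow> cos (\<kappa> * Im w) \<le> - \<delta> \<Longrightarrow> norm (?K w) \<le> A * exp (- Re w)"
    using hankel_kernel_decay assms by blast
  have K_le: "norm (?K (Complex x y)) \<le> A * exp (- x)" if "x \<ge> c" "y \<in> {p..q}" for x y
    using A(2)[of "Complex x y"] assms(4) that by auto
  have int: "(\<lambda>x. ?K (Complex x y)) integrable_on {c..}" if "y \<in> {p..q}" for y
  proof -
    have "(\<lambda>x. ?K (Complex x y)) absolutely_integrable_on {c..}"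
      by (rule absolutely_integrable_exp_bound[where A = A]) (intro continuous_intros K_le that | assumption)+
    thus ?thesis by (simp add: absolutely_integrable_on_def)
  qed
  \<comment> \<open>By Cauchy's theorem on [c,d] x [p,q] this difference has the same value at d as
    at c, and each of its three terms at d is O(exp(-d)).\<close>
  have "?I c p - ?I c q - ?J c = 0"
  proof (rule eq_0_if_norm_le_exp)
    fix d assume d: "d > c"
    have "?I c p - ?I c q - ?J c = ?I d p - ?I d q - ?J d"
      using rectangle_integral_eq_0[OF d assms(3), of ?K UNIV] assms(3)
        integral_atLeast_split(1)[OF int[of p], of d] integral_atLeast_split(1)[OF int[of q], of d] d
      by (simp add: holomorphic_hankel_kernel[of "\<lambda>w. w"] algebra_simps)
    moreover have "norm (?I d y) \<le> A * exp (- d)" if "y \<in> {p..q}" for y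
      using d that by (intro norm_integral_exp_bound K_le continuous_intros) auto
    moreover have "norm (?J d) \<le> A * exp (- d) * (q - p)"
    proof -
      have "norm (integral {p..q} (\<lambda>y. ?K (Complex d y))) \<le> integral {p..q} (\<lambda>y. A * exp (- d))"
        using d by (intro integral_norm_bound_integral integrable_continuous_real K_le continuous_intros) auto
      thus ?thesis using assms(3) by (simp add: norm_mult mult_ac)
    qed
    ultimately have "norm (?I c p - ?I c q - ?J c) \<le> A * exp (- d) + A * exp (- d) + A * exp (- d) * (q - p)"
      using assms(3) by (metis norm_diff_le atLeastAtMost_iff less_imp_le order.refl)
    thus "norm (?I c p - ?I c q - ?J c) \<le> (2 * A + A * (q - p)) * exp (- d)"
      by (simp add: algebra_simps)
  qed
  thus ?thesis by simp
qed

text \<open>The strips between the angles \<theta> and \<phi>, above and below the real axis, are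
  swept separately. On both, \<kappa>|y| lies in [\<kappa>\<theta>, \<pi>], where the cosine stays
  below cos(\<kappa>\<theta>) < 0; the vertical segment is lengthened by what the two sweeps
  contribute.\<close>

lemma hankel_kernel_change_angle:
  assumes "\<kappa> > 0" "pi / 2 < \<kappa> * \<theta>" "\<theta> < \<phi>" "\<kappa> * \<phi> \<le> pi"
  shows "hankel_integral c \<theta> (hankel_kernel \<kappa> a) = hankel_integral c \<phi> (hankel_kernel \<kappa> a)"
proof -
  let ?J = "\<lambda>p q. integral {p..q} (\<lambda>y. hankel_kernel \<kappa> a (Complex c y))"
  have "0 < \<kappa> * \<theta>" using assms pi_half_gt_zero by linarith
  hence \<theta>: "\<theta> > 0" using assms(1) by (simp add: zero_less_mult_iff)
  have "\<kappa> * \<theta> \<le> pi" using assms mult_strict_left_mono[of \<theta> \<phi> \<kappa>] by linarith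
  hence neg: "- cos (\<kappa> * \<theta>) > 0" using cos_le_cos_angle(2)[of "\<kappa> * \<theta>" "\<kappa> * \<theta>"] assms \<theta> by auto
  have cos: "cos (\<kappa> * y) \<le> cos (\<kappa> * \<theta>)" if "y \<in> {\<theta>..\<phi>} \<or> y \<in> {- \<phi>..- \<theta>}" for y
  proof (rule cos_le_cos_angle(1))
    have y: "\<bar>y\<bar> \<le> \<phi>" "\<theta> \<le> \<bar>y\<bar>" using that \<theta> by auto
    have "\<kappa> * \<bar>y\<bar> \<le> \<kappa> * \<phi>" "\<kappa> * \<theta> \<le> \<kappa> * \<bar>y\<bar>" by (intro mult_left_mono; use y assms in simp)+
    thus "\<kappa> * \<theta> \<le> \<bar>\<kappa> * y\<bar>" "\<bar>\<kappa> * y\<bar> \<le> pi"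
      unfolding abs_mult using assms(1,4) by linarith+
  qed (use assms \<open>\<kappa> * \<theta> \<le> pi\<close> in auto)
  have int: "(\<lambda>y. hankel_kernel \<kappa> a (Complex c y)) integrable_on {u..v}" for u v
    by (intro integrable_continuous_real continuous_intros)
  have "?J (-\<phi>) \<phi> = ?J (-\<phi>) (-\<theta>) + ?J (-\<theta>) \<phi>" "?J (-\<theta>) \<phi> = ?J (-\<theta>) \<theta> + ?J \<theta> \<phi>"
    using assms(3) \<theta> by (auto intro!: Henstock_Kurzweil_Integration.integral_combine[symmetric] int)
  hence J: "\<i> * ?J (-\<phi>) \<phi> = \<i> * ?J (-\<phi>) (-\<theta>) + \<i> * ?J (-\<theta>) \<theta> + \<i> * ?J \<theta> \<phi>"
    by (simp add: algebra_simps)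
  show ?thesis
    using hankel_kernel_shift_angle[OF assms(1) neg, of \<theta> \<phi> c a]
      hankel_kernel_shift_angle[OF assms(1) neg, of "-\<phi>" "-\<theta>" c a] assms(3) cos J
    unfolding hankel_integral_def by (simp add: algebra_simps)
qed

text \<open>The contour form of \<Gamma>(s+1) = s \<Gamma>(s): the integrand D is the derivative of
  \<open>hankel_kernel \<kappa> a\<close>, which tends to 0 at both ends of the contour.\<close>

lemma hankel_integral_kernel_rec:
  assumes "\<kappa> > 0" "pi / 2 < \<kappa> * \<theta>" "\<kappa> * \<theta> \<le> pi"
  shows "\<kappa> * hankel_integral c \<theta> (hankel_kernel \<kappa> (a + \<kappa>)) + a * hankel_integral c \<theta> (hankel_kernel \<kappa> a) = 0"
proof -
  let ?K = "hankel_kernel \<kappa> a"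
  define D where "D w = \<kappa> * hankel_kernel \<kappa> (a + \<kappa>) w + a * ?K w" for w
  have "0 < \<kappa> * \<theta>" using assms pi_half_gt_zero by linarith
  hence \<theta>: "\<theta> > 0" using assms(1) by (simp add: zero_less_mult_iff)
  have D_int: "hankel_integrable c \<theta> D" for c
    unfolding D_def by (intro hankel_integrable_add hankel_integrable_cmult hankel_integrable_kernel assms)
  have D_cont: "continuous_on S (\<lambda>x. D (f x))" if "continuous_on S f" for S and f :: "real \<Rightarrow> complex"
    unfolding D_def by (intro continuous_intros that)
  have D_holo: "D holomorphic_on UNIV"
    unfolding D_def by (intro holomorphic_intros)
  obtain A where A: "A > 0" "\<And>w. w \<in> log_contour c \<theta> \<Longrightarrow> norm (?K w) \<le> A * exp (- Re w)"
    using hankel_kernel_log_contour_decay assms by blast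
  obtain B where B: "B > 0" "\<And>w. w \<in> log_contour c \<theta> \<Longrightarrow> norm (hankel_kernel \<kappa> (a + \<kappa>) w) \<le> B * exp (- Re w)"
    using hankel_kernel_log_contour_decay assms by blast
  define C where "C = \<kappa> * B + \<bar>a\<bar> * A"
  have D_le: "norm (D w) \<le> C * exp (- Re w)" if "w \<in> log_contour c \<theta>" for w
  proof -
    have "norm (D w) \<le> \<kappa> * norm (hankel_kernel \<kappa> (a + \<kappa>) w) + \<bar>a\<bar> * norm (?K w)"
      unfolding D_def using assms(1) by (intro norm_triangle_le) (simp add: norm_mult)
    also have "\<dots> \<le> \<kappa> * (B * exp (- Re w)) + \<bar>a\<bar> * (A * exp (- Re w))"
      using assms(1) A B that by (intro add_mono mult_left_mono) auto
    finally show ?thesis by (simp add: C_def algebra_simps)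
  qed
  have "hankel_integral c \<theta> D = 0"
  proof (rule eq_0_if_norm_le_exp)
    fix d assume d: "d > c"
    \<comment> \<open>The contour is moved to Re w = d. The antiderivative is then needed only on
      the vertical segment, where its end values are O(exp(-d)); the rays are estimated
      directly.\<close>
    have vert: "((\<lambda>y. \<i> * D (Complex d y)) has_integral (?K (Complex d \<theta>) - ?K (Complex d (-\<theta>)))) {-\<theta>..\<theta>}"
    proof (rule fundamental_theorem_of_calculus)
      show "((\<lambda>y. ?K (Complex d y)) has_vector_derivative \<i> * D (Complex d y)) (at y within {-\<theta>..\<theta>})" for y
      proof -
        have "((\<lambda>y. Complex d y) has_vector_derivative \<i>) (at y within {-\<theta>..\<theta>})"
          unfolding Complex_eq by (auto intro!: derivative_eq_intros)
        from field_vector_diff_chain_within[OF this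
            has_field_derivative_at_within[OF hankel_kernel_DERIV[of \<kappa> a]]]
        show ?thesis by (simp add: D_def o_def)
      qed
    qed (use \<theta> in auto)
    have "norm (integral {d..} (\<lambda>x. D (Complex x y))) \<le> C * exp (- d)" if "y = \<theta> \<or> y = - \<theta>" for y
    proof (rule norm_integral_exp_bound)
      show "norm (D (Complex x y)) \<le> C * exp (- x)" if "x \<ge> d" for x
        using D_le[of "Complex x y"] in_log_contour(1,2)[of \<theta> c x] \<theta> d that \<open>y = \<theta> \<or> y = - \<theta>\<close> by auto
    qed (intro D_cont continuous_intros)
    hence "norm (integral {d..} (\<lambda>x. D (Complex x \<theta>))) \<le> C * exp (- d)"
      "norm (integral {d..} (\<lambda>x. D (Complex x (- \<theta>)))) \<le> C * exp (- d)" by blast+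
    moreover have "norm (?K (Complex d \<theta>)) \<le> A * exp (- d)" "norm (?K (Complex d (- \<theta>))) \<le> A * exp (- d)"
      using A(2)[OF in_log_contour(1)[of \<theta> c d]] A(2)[OF in_log_contour(2)[of \<theta> c d]] \<theta> d by auto
    moreover have "hankel_integral c \<theta> D = integral {d..} (\<lambda>x. D (Complex x \<theta>))
        - integral {d..} (\<lambda>x. D (Complex x (- \<theta>))) + (?K (Complex d \<theta>) - ?K (Complex d (-\<theta>)))"
      using hankel_integral_shift_eq[OF D_int[of c], of d] d D_holo \<theta> integral_unique[OF vert]
      by (simp add: hankel_integral_def)
    ultimately have "norm (hankel_integral c \<theta> D) \<le> C * exp (-d) + C * exp (-d) + (A * exp (-d) + A * exp (-d))"
      by (metis norm_add_le norm_diff_le)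
    thus "norm (hankel_integral c \<theta> D) \<le> (2 * C + 2 * A) * exp (-d)" by (simp add: algebra_simps)
  qed
  thus ?thesis
    unfolding D_def by (subst (asm) hankel_integral_add;
        (intro hankel_integrable_cmult hankel_integrable_kernel assms)?; simp add: hankel_integral_cmult)
qed

section \<open>Euler's integral and the limiting contour of angle \<pi>/\<kappa>\<close>

lemma integral_double_exp:
  fixes \<kappa> a :: real
  assumes "\<kappa> > 0" "a > 0"
  shows "((\<lambda>x. exp (- exp (\<kappa> * x)) * exp (a * x)) has_integral Gamma (a / \<kappa>) / \<kappa>) UNIV"
proof -
  define f where "f = (\<lambda>t::real. t powr (a / \<kappa> - 1) / exp t)"
  \<comment> \<open>The substitution t = exp(\<kappa> x) maps the line onto the positive half-line,
    so the integral is Euler's integral for \<Gamma>(a/\<kappa>), up to the factor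
    1/\<kappa>.\<close>
  let ?g = "\<lambda>x. exp (\<kappa> * x)"
  have im: "?g ` UNIV = {0<..}"
  proof (intro equalityI subsetI)
    fix t :: real assume "t \<in> {0<..}"
    thus "t \<in> ?g ` UNIV" using assms by (intro image_eqI[of _ _ "ln t / \<kappa>"]) auto
  qed auto
  have "(f has_integral Gamma (a / \<kappa>)) {0..}"
    unfolding f_def using assms by (intro Gamma_integral_real) auto
  moreover have "negligible {x \<in> {0..} - {0<..}. f x \<noteq> 0}"
    by (rule negligible_subset[of "{0}"]) auto
  moreover have "{x \<in> {0<..} - {0..}. f x \<noteq> 0} = {}"
    by auto
  ultimately have f: "(f has_integral Gamma (a / \<kappa>)) {0<..}"
    using has_integral_spike_set_eq[of "{0..}" "{0<..}" f] by (metis negligible_empty)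
  have f_abs: "f absolutely_integrable_on {0<..}"
    by (rule nonnegative_absolutely_integrable_1[OF has_integral_integrable[OF f]]) (simp add: f_def)
  have inj: "inj ?g" using assms by (auto simp: inj_def)
  have der: "(?g has_field_derivative \<kappa> * ?g x) (at x within UNIV)" for x
    by (auto intro!: derivative_eq_intros)
  have "(\<lambda>x. \<bar>\<kappa> * ?g x\<bar> * f (?g x)) absolutely_integrable_on UNIV \<and>
      integral UNIV (\<lambda>x. \<bar>\<kappa> * ?g x\<bar> * f (?g x)) = Gamma (a / \<kappa>)"
    unfolding has_absolute_integral_change_of_variables_1'[OF _ der inj, simplified] im
    using f_abs integral_unique[OF f] by simp
  hence "((\<lambda>x. \<bar>\<kappa> * ?g x\<bar> * f (?g x)) has_integral Gamma (a / \<kappa>)) UNIV"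
    by (simp add: absolutely_integrable_on_def has_integral_integrable_integral)
  hence "((\<lambda>x. (\<bar>\<kappa> * ?g x\<bar> * f (?g x)) / \<kappa>) has_integral Gamma (a / \<kappa>) / \<kappa>) UNIV"
    by (rule has_integral_divide)
  also have "(\<lambda>x. (\<bar>\<kappa> * ?g x\<bar> * f (?g x)) / \<kappa>) = (\<lambda>x. exp (- exp (\<kappa> * x)) * exp (a * x))"
  proof
    fix x :: real
    have "?g x * ?g x powr (a / \<kappa> - 1) = exp (a * x)"
      using assms by (simp add: powr_def mult_exp_exp field_simps)
    thus "(\<bar>\<kappa> * ?g x\<bar> * f (?g x)) / \<kappa> = exp (- exp (\<kappa> * x)) * exp (a * x)"
      using assms by (simp add: f_def exp_minus abs_mult field_simps)
  qed
  finally show ?thesis .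
qed

text \<open>As Re w tends to minus infinity, exp(exp(\<kappa> w)) tends to 1 and exp(a w) to 0,
  except for a = 0, where it is 1. That exceptional case supplies the whole value of the limit when
  the sine factor of the rays vanishes. The constant e dominates throughout.\<close>

lemma hankel_kernel_vertical_tendsto:
  assumes "\<kappa> > 0" "a \<ge> 0" "\<phi> \<ge> 0"
  shows "(\<lambda>n. integral {-\<phi>..\<phi>} (\<lambda>y. hankel_kernel \<kappa> a (Complex (- real n) y)))
           \<longlonglongrightarrow> (if a = 0 then 2 * \<phi> else 0)"
proof -
  let ?f = "\<lambda>n y. hankel_kernel \<kappa> a (Complex (- real n) y)"
  let ?l = "if a = 0 then 1 else 0 :: complex"
  have "(\<lambda>n. integral {-\<phi>..\<phi>} (?f n)) \<longlonglongrightarrow> integral {-\<phi>..\<phi>} (\<lambda>y. ?l)"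
  proof (rule dominated_convergence)
    show "?f n integrable_on {-\<phi>..\<phi>}" for n
      by (intro integrable_continuous_real continuous_intros)
    show "(\<lambda>y. exp 1 :: real) integrable_on {-\<phi>..\<phi>}"
      by (intro integrable_continuous_real continuous_intros)
    show "norm (?f n y) \<le> exp 1" for n y
    proof -
      have "exp (\<kappa> * - real n) * cos (\<kappa> * y) \<le> exp (\<kappa> * - real n) * 1"
        by (intro mult_left_mono) auto
      also have "\<dots> \<le> 1" using assms(1) by simp
      finally have "exp (\<kappa> * - real n) * cos (\<kappa> * y) \<le> 1" .
      moreover have "a * - real n \<le> 0" using assms(2) by simp
      ultimately have "norm (?f n y) \<le> exp 1 * exp 0"
        unfolding norm_hankel_kernel complex.sel by (intro mult_mono) auto
      thus ?thesis by simp
    qed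
    show "(\<lambda>n. ?f n y) \<longlonglongrightarrow> ?l" for y
    proof -
      have *: "(\<lambda>n. exp (of_real b * Complex (- real n) y)) \<longlonglongrightarrow> (0::complex)" if "b > 0" for b
      proof (rule tendsto_norm_zero_cancel)
        have "(\<lambda>n. exp (- b * real n)) \<longlonglongrightarrow> 0" using that by real_asymp
        thus "(\<lambda>n. norm (exp (of_real b * Complex (- real n) y))) \<longlonglongrightarrow> 0" by simp
      qed
      have "(\<lambda>n. exp (exp (of_real \<kappa> * Complex (- real n) y))) \<longlonglongrightarrow> exp (0::complex)"
        by (intro tendsto_exp * assms)
      moreover have "(\<lambda>n. exp (of_real a * Complex (- real n) y)) \<longlonglongrightarrow> ?l"
        using *[of a] assms(2) by (cases "a = 0") auto
      ultimately show ?thesis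
        using tendsto_mult[of _ "exp 0"] unfolding hankel_kernel_def by fastforce
    qed
  qed
  also have "integral {-\<phi>..\<phi>} (\<lambda>y. ?l) = (if a = 0 then 2 * \<phi> else 0)"
    using assms(3) by (simp add: scaleR_conv_of_real)
  finally show ?thesis .
qed

text \<open>For \<kappa>\<phi> = \<pi>, exp(\<kappa> w) is the same negative number -exp(\<kappa> x)
  on both rays. They differ only in the phases cis(a\<phi>) and cis(-a\<phi>), whose difference is
  2i sin(a\<phi>).\<close>

lemma hankel_integral_kernel_pi:
  assumes "\<kappa> > 0" "\<kappa> * \<phi> = pi"
  shows "hankel_integral c \<phi> (hankel_kernel \<kappa> a) =
    2 * \<i> * sin (a * \<phi>) * integral {c..} (\<lambda>x. exp (- exp (\<kappa> * x)) * exp (a * x))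
    + \<i> * integral {-\<phi>..\<phi>} (\<lambda>y. hankel_kernel \<kappa> a (Complex c y))"
proof -
  let ?g = "\<lambda>x. exp (- exp (\<kappa> * x)) * exp (a * x)"
  have k: "hankel_kernel \<kappa> a (Complex x \<phi>) = cis (a * \<phi>) * of_real (?g x)"
    "hankel_kernel \<kappa> a (Complex x (-\<phi>)) = cis (- (a * \<phi>)) * of_real (?g x)" for x
  proof -
    have "exp (of_real \<kappa> * Complex x y) = of_real (- exp (\<kappa> * x))" if "\<bar>y\<bar> = \<phi>" for y
    proof -
      have "\<kappa> * y = pi \<or> \<kappa> * y = - pi" using that assms(2) by (auto simp: abs_if split: if_splits)
      thus ?thesis by (auto simp: exp_eq_polar complex_eq_iff)
    qed
    moreover have "exp (of_real a * Complex x y) = of_real (exp (a * x)) * cis (a * y)" for y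
      by (simp add: exp_eq_polar)
    moreover have "\<phi> \<ge> 0" using assms pi_gt_zero by (metis less_imp_le zero_less_mult_pos)
    ultimately show "hankel_kernel \<kappa> a (Complex x \<phi>) = cis (a * \<phi>) * of_real (?g x)"
      "hankel_kernel \<kappa> a (Complex x (-\<phi>)) = cis (- (a * \<phi>)) * of_real (?g x)"
      unfolding hankel_kernel_def by (simp_all add: exp_of_real[symmetric])
  qed
  have o: "integral {c..} (\<lambda>x. of_real (?g x) :: complex) = of_real (integral {c..} ?g)"
  proof -
    obtain A where A: "\<And>x. x \<ge> c \<Longrightarrow> ?g x \<le> A * exp (- x)"
      using double_exp_decay[of 1 \<kappa> c a] assms(1) by auto
    have "?g absolutely_integrable_on {c..}"
      by (rule absolutely_integrable_exp_bound[where A = A]) (use A in \<open>auto intro!: continuous_intros\<close>)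
    hence "?g integrable_on {c..}" by (simp add: absolutely_integrable_on_def)
    from has_integral_of_real[OF integrable_integral[OF this]] show ?thesis
      by (rule integral_unique)
  qed
  have "cis (a * \<phi>) - cis (- (a * \<phi>)) = 2 * \<i> * sin (a * \<phi>)"
    by (simp add: complex_eq_iff)
  moreover have "hankel_integral c \<phi> (hankel_kernel \<kappa> a) =
     (cis (a * \<phi>) - cis (- (a * \<phi>))) * of_real (integral {c..} ?g)
     + \<i> * integral {-\<phi>..\<phi>} (\<lambda>y. hankel_kernel \<kappa> a (Complex c y))"
    unfolding hankel_integral_def k integral_mult_right o by (simp only: left_diff_distrib)
  ultimately show ?thesis by simp
qed

lemma integral_atLeast_tendsto_UNIV:
  fixes g :: "real \<Rightarrow> real"
  assumes "g integrable_on UNIV" "\<And>x. g x \<ge> 0"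
  shows "(\<lambda>n. integral {- real n..} g) \<longlonglongrightarrow> integral UNIV g"
proof -
  let ?f = "\<lambda>n x. if x \<in> {- real n..} then g x else 0"
  have int: "g integrable_on {- real n..}" for n
    using nonnegative_absolutely_integrable_1[OF assms(1)] assms(2)
      set_integrable_subset[of lebesgue UNIV g "{- real n..}"]
    by (simp add: absolutely_integrable_on_def)
  have "(\<lambda>n. integral UNIV (?f n)) \<longlonglongrightarrow> integral UNIV g"
  proof (rule dominated_convergence[OF _ assms(1)])
    show "?f n integrable_on UNIV" for n
      using int by (subst integrable_restrict_UNIV)
    show "norm (?f n x) \<le> g x" for n x using assms(2) by simp
    show "(\<lambda>n. ?f n x) \<longlonglongrightarrow> g x" for x
    proof (rule tendsto_eventually)
      obtain N :: nat where "- x \<le> real N" using real_arch_simple by blast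
      thus "eventually (\<lambda>n. ?f n x = g x) sequentially"
        unfolding eventually_sequentially by (intro exI[of _ N]) auto
    qed
  qed
  thus ?thesis by (simp only: integral_restrict_UNIV)
qed

text \<open>The integral does not depend on c, so c = -n may be sent to minus infinity; a \<ge> 0
  keeps the vertical segment under control there. The rays yield sin(a\<phi>)
  \<Gamma>(a/\<kappa>)/\<kappa>, which the reflection formula converts into a reciprocal Gamma
  value.\<close>

lemma hankel_integral_kernel_nonneg:
  assumes "\<kappa> > 0" "\<kappa> * \<phi> = pi" "a \<ge> 0"
  shows "hankel_integral c \<phi> (hankel_kernel \<kappa> a) = 2 * pi * \<i> / \<kappa> * complex_of_real (rGamma (1 - a / \<kappa>))"
proof -
  let ?g = "\<lambda>x. exp (- exp (\<kappa> * x)) * exp (a * x)"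
  let ?H = "\<lambda>c. hankel_integral c \<phi> (hankel_kernel \<kappa> a)"
  have \<phi>: "\<phi> > 0" using assms pi_gt_zero by (metis zero_less_mult_pos)
  have \<phi>_eq: "\<phi> = pi / \<kappa>" using assms by (simp add: field_simps)
  \<comment> \<open>At a = 0 the integral over the whole line diverges, but its factor sin(a\<phi>)
    is 0 for every n. The value of G there is a convention.\<close>
  define G where "G = (if a = 0 then 0 else Gamma (a / \<kappa>) / \<kappa>)"
  have const: "?H c' = ?H c" for c'
  proof -
    have int: "hankel_integrable d \<phi> (hankel_kernel \<kappa> a)" for d
      using assms pi_gt_zero by (intro hankel_integrable_kernel) auto
    have "hankel_kernel \<kappa> a holomorphic_on UNIV"
      using holomorphic_hankel_kernel[of "\<lambda>w. w"] by (simp add: holomorphic_on_ident)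
    from hankel_integral_shift_eq[OF int _ \<phi> this] show ?thesis
      by (metis linear)
  qed
  have "(\<lambda>n. sin (a * \<phi>) * integral {- real n..} ?g) \<longlonglongrightarrow> sin (a * \<phi>) * G"
  proof (cases "a = 0")
    case False
    hence "(?g has_integral G) UNIV"
      unfolding G_def using integral_double_exp[of \<kappa> a] assms by simp
    thus ?thesis
      using integral_atLeast_tendsto_UNIV[of ?g] by (auto intro!: tendsto_mult_left
          simp: integral_unique has_integral_integrable)
  qed auto
  note lim = this
  have "(\<lambda>n. 2 * \<i> * complex_of_real (sin (a * \<phi>) * integral {- real n..} ?g)
     + \<i> * integral {-\<phi>..\<phi>} (\<lambda>y. hankel_kernel \<kappa> a (Complex (- real n) y)))
     \<longlonglongrightarrow> 2 * \<i> * complex_of_real (sin (a * \<phi>) * G) + \<i> * (if a = 0 then 2 * \<phi> else 0)"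
    using \<phi> assms by (intro tendsto_add tendsto_mult_left tendsto_of_real lim hankel_kernel_vertical_tendsto) auto
  moreover have "(\<lambda>n. 2 * \<i> * complex_of_real (sin (a * \<phi>) * integral {- real n..} ?g)
     + \<i> * integral {-\<phi>..\<phi>} (\<lambda>y. hankel_kernel \<kappa> a (Complex (- real n) y))) = (\<lambda>n. ?H c)"
  proof
    fix n :: nat
    show "2 * \<i> * complex_of_real (sin (a * \<phi>) * integral {- real n..} ?g)
     + \<i> * integral {-\<phi>..\<phi>} (\<lambda>y. hankel_kernel \<kappa> a (Complex (- real n) y)) = ?H c"
      using hankel_integral_kernel_pi[OF assms(1,2), of "- real n" a] const[of "- real n"]
      by (simp add: mult.assoc)
  qed
  ultimately have "?H c = 2 * \<i> * complex_of_real (sin (a * \<phi>) * G) + \<i> * (if a = 0 then 2 * \<phi> else 0)"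
    by (simp add: LIMSEQ_const_iff)
  also have "\<dots> = 2 * pi * \<i> / \<kappa> * complex_of_real (rGamma (1 - a / \<kappa>))"
  proof (cases "a = 0")
    case False
    define s where "s = a / \<kappa>"
    have s: "s > 0" using False assms by (simp add: s_def)
    have "complex_of_real (rGamma s * rGamma (1 - s)) = of_real (sin (pi * s) / pi)"
      using rGamma_reflection_complex[of "of_real s"]
      by (simp add: rGamma_complex_of_real[symmetric] sin_of_real[symmetric] del: sin_of_real)
    hence "rGamma s * rGamma (1 - s) = sin (pi * s) / pi" by (simp only: of_real_eq_iff)
    hence "sin (pi * s) * Gamma s = pi * rGamma (1 - s)"
    proof -
      assume *: "rGamma s * rGamma (1 - s) = sin (pi * s) / pi"
      have "Gamma s * rGamma s = 1"
        using Gamma_real_pos[OF s] by (simp add: rGamma_inverse_Gamma)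
      hence "pi * rGamma (1 - s) = pi * Gamma s * (rGamma s * rGamma (1 - s))"
        by (simp add: mult_ac)
      thus ?thesis unfolding * by simp
    qed
    moreover have "sin (a * \<phi>) = sin (pi * s)" by (simp add: s_def \<phi>_eq mult_ac)
    ultimately have "sin (a * \<phi>) * G = pi * rGamma (1 - s) / \<kappa>"
      using False by (simp add: G_def s_def)
    hence "complex_of_real (sin (a * \<phi>) * G) = of_real (pi * rGamma (1 - s) / \<kappa>)" by simp
    thus ?thesis using False by (simp add: s_def mult_ac)
  qed (simp_all add: \<phi>_eq)
  finally show ?thesis .
qed

text \<open>Rotation to the angle \<pi>/\<kappa> settles a \<ge> 0. Each induction step lowers the
  admissible a by \<kappa>: the recursion expresses a times the integral at a through the integral
  at a + \<kappa>, and a negative a can be cancelled.\<close>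

lemma hankel_formula:
  assumes "\<kappa> > 0" "pi / 2 < \<kappa> * \<theta>" "\<kappa> * \<theta> < pi"
  shows "hankel_integral c \<theta> (hankel_kernel \<kappa> a) = 2 * pi * \<i> / \<kappa> * complex_of_real (rGamma (1 - a / \<kappa>))"
proof -
  let ?H = "\<lambda>a. hankel_integral c \<theta> (hankel_kernel \<kappa> a)"
  have "\<forall>a \<ge> - real n * \<kappa>. ?H a = 2 * pi * \<i> / \<kappa> * complex_of_real (rGamma (1 - a / \<kappa>))" for n
  proof (induction n)
    case 0
    have "\<theta> < pi / \<kappa>" using assms by (simp add: field_simps)
    hence "?H a = hankel_integral c (pi / \<kappa>) (hankel_kernel \<kappa> a)" for a
      using assms by (intro hankel_kernel_change_angle) auto
    thus ?case using hankel_integral_kernel_nonneg[of \<kappa> "pi / \<kappa>"] assms by simp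
  next
    case (Suc n)
    show ?case
    proof (intro allI impI)
      fix a assume a: "a \<ge> - real (Suc n) * \<kappa>"
      show "?H a = 2 * pi * \<i> / \<kappa> * complex_of_real (rGamma (1 - a / \<kappa>))"
      proof (cases "a \<ge> 0")
        case True
        moreover have "- real n * \<kappa> \<le> 0" using assms(1) by simp
        ultimately show ?thesis using Suc.IH by fastforce
      next
        case False
        have "a + \<kappa> \<ge> - real n * \<kappa>" using a by (simp add: algebra_simps)
        hence IH: "?H (a + \<kappa>) = 2 * pi * \<i> / \<kappa> * complex_of_real (rGamma (1 - (a + \<kappa>) / \<kappa>))" using Suc.IH by blast
        have rec: "\<kappa> * ?H (a + \<kappa>) + a * ?H a = 0"
          using hankel_integral_kernel_rec[of \<kappa> \<theta> c a] assms by simp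
        have "1 - (a + \<kappa>) / \<kappa> = - a / \<kappa>" using assms(1) by (simp add: field_simps)
        \<comment> \<open>The functional equation of 1/\<Gamma> at -a/\<kappa>; it matches the
          recursion of the integrals.\<close>
        hence "rGamma (1 - (a + \<kappa>) / \<kappa>) = - a / \<kappa> * rGamma (1 - a / \<kappa>)"
          using rGamma_plus1[of "- a / \<kappa>"] by (simp add: add.commute)
        hence r': "complex_of_real (rGamma (1 - (a + \<kappa>) / \<kappa>))
            = of_real (- a / \<kappa>) * of_real (rGamma (1 - a / \<kappa>))"
          by (simp only: of_real_mult)
        have "a * ?H a = - (\<kappa> * ?H (a + \<kappa>))"
          using rec by (simp add: add_eq_0_iff)
        also have "\<dots> = a * (2 * pi * \<i> / \<kappa> * complex_of_real (rGamma (1 - a / \<kappa>)))"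
          unfolding IH r' using assms(1) by simp
        finally have "a * ?H a = a * (2 * pi * \<i> / \<kappa> * complex_of_real (rGamma (1 - a / \<kappa>)))" .
        moreover have "complex_of_real a \<noteq> 0" using False by auto
        ultimately show ?thesis by (metis mult_left_cancel)
      qed
    qed
  qed
  moreover obtain n :: nat where "- a / \<kappa> \<le> real n" using real_arch_simple by blast
  hence "a \<ge> - real n * \<kappa>" using assms(1) by (simp add: field_simps)
  ultimately show ?thesis by blast
qed

subsection \<open>Integral representation of the Mittag-Leffler function\<close>

text \<open>This is exp(\<zeta>^\<kappa>) \<zeta>^b/(\<zeta> - z) d\<zeta> in the variable w. The
  exponent b belongs to \<beta> = 1 - b/\<kappa>: with \<alpha> = 1/\<kappa>, b = 0 gives \<beta> =
  1 and b = \<kappa> - 1 gives \<beta> = \<alpha>.\<close>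

definition ml_kernel :: "real \<Rightarrow> real \<Rightarrow> complex \<Rightarrow> complex \<Rightarrow> complex" where
  "ml_kernel \<kappa> b z w = hankel_kernel \<kappa> b w * (exp w / (exp w - z))"

lemma continuous_on_ml_kernel:
  assumes "\<And>w. w \<in> S \<Longrightarrow> exp w \<noteq> z"
  shows "continuous_on S (ml_kernel \<kappa> b z)"
  unfolding ml_kernel_def using assms by (intro continuous_intros) auto

lemma holomorphic_on_ml_kernel:
  assumes "\<And>w. w \<in> S \<Longrightarrow> exp w \<noteq> z"
  shows "ml_kernel \<kappa> b z holomorphic_on S"
  unfolding ml_kernel_def using assms by (intro holomorphic_intros) auto

lemma hankel_kernel_diff_nat:
  "hankel_kernel \<kappa> (b - real k) w = hankel_kernel \<kappa> b w * exp (- w) ^ k"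
  by (simp add: hankel_kernel_def exp_of_nat_mult[symmetric] mult_exp_exp algebra_simps)

text \<open>On the contour the ratio z exp(-w) of the geometric series has modulus at most q = |z|
  exp(-c) < 1. Sum and integral are interchanged through the exact remainder of the finite geometric
  sum, whose integral is O(q^n).\<close>

lemma ml_kernel_sums:
  assumes \<kappa>: "\<kappa> > 0" "pi / 2 < \<kappa> * \<theta>" "\<kappa> * \<theta> < pi" and z: "cmod z < exp c"
  shows "(\<lambda>k. z ^ k * hankel_integral c \<theta> (hankel_kernel \<kappa> (b - real k))) sums
           hankel_integral c \<theta> (ml_kernel \<kappa> b z)"
proof -
  define q where "q = cmod z * exp (- c)"
  have q: "0 \<le> q" "q < 1" using z by (auto simp: q_def exp_minus field_simps)
  have "0 < \<kappa> * \<theta>" using \<kappa> pi_half_gt_zero by linarith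
  hence \<theta>: "\<theta> \<ge> 0" using \<kappa>(1) by (simp add: zero_less_mult_iff)
  let ?K = "hankel_kernel \<kappa> b" and ?G = "ml_kernel \<kappa> b z"
  have ratio: "norm (z * exp (- w)) \<le> q" if "w \<in> log_contour c \<theta>" for w
  proof -
    have "Re w \<ge> c" using that by (auto simp: log_contour_def)
    thus ?thesis unfolding q_def by (simp add: norm_mult mult_left_mono)
  qed
  have ne: "exp w \<noteq> z" if "w \<in> log_contour c \<theta>" for w
  proof
    assume "exp w = z"
    hence "z * exp (- w) = 1" by (metis exp_minus_inverse)
    thus False using ratio[OF that] q by simp
  qed
  have G_eq: "?G w = ?K w / (1 - z * exp (- w))" for w
    unfolding ml_kernel_def by (simp add: exp_minus field_simps)
  have G_le: "norm (?G w) \<le> 1 / (1 - q) * norm (?K w)" if "w \<in> log_contour c \<theta>" for w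
  proof -
    have "1 - q \<le> norm (1 - z * exp (- w))"
      using ratio[OF that] norm_triangle_ineq2[of 1 "z * exp (- w)"] by simp
    thus ?thesis unfolding G_eq norm_divide using q
      by (simp add: frac_le)
  qed
  have G_cont: "continuous_on (log_contour c \<theta>) ?G"
    by (rule continuous_on_ml_kernel) (rule ne)
  have G_int: "hankel_integrable c \<theta> ?G"
    by (rule hankel_integrable_kernel_bounded[where C = "1 / (1 - q)" and a = b and \<kappa> = \<kappa>])
       (use G_cont G_le \<kappa> q in auto)
  let ?R = "\<lambda>n w. (z * exp (- w)) ^ n * ?G w"
  have R_cont: "continuous_on (log_contour c \<theta>) (?R n)" for n
    by (intro continuous_intros G_cont)
  have R_le: "norm (?R n w) \<le> q ^ n / (1 - q) * norm (?K w)" if "w \<in> log_contour c \<theta>" for n w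
  proof -
    have "norm (?R n w) \<le> q ^ n * (1 / (1 - q) * norm (?K w))"
      unfolding norm_mult[of "_ ^ n"] norm_power using q
      by (intro mult_mono power_mono ratio G_le that) auto
    thus ?thesis by simp
  qed
  have R_int: "hankel_integrable c \<theta> (?R n)" for n
    by (rule hankel_integrable_kernel_bounded[where C = "q ^ n / (1 - q)" and a = b and \<kappa> = \<kappa>])
       (use R_cont R_le \<kappa> q in auto)
  let ?V = "hankel_length_integral c \<theta> (\<lambda>w. norm (?K w))"
  have V_int: "hankel_integrable c \<theta> (\<lambda>w. q ^ n / (1 - q) * norm (?K w))" for n
    by (rule hankel_integrable_kernel_bounded[where C = "q ^ n / (1 - q)" and a = b and \<kappa> = \<kappa>])
       (use \<kappa> q in \<open>auto intro!: continuous_intros simp: abs_mult\<close>)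
  let ?S = "\<lambda>n. \<Sum>k<n. z ^ k * hankel_integral c \<theta> (hankel_kernel \<kappa> (b - real k))"
  have split: "hankel_integral c \<theta> ?G - ?S n = hankel_integral c \<theta> (?R n)" for n
  proof -
    have "hankel_integral c \<theta> ?G = hankel_integral c \<theta>
       (\<lambda>w. (\<Sum>k<n. z ^ k * hankel_kernel \<kappa> (b - real k) w) + ?R n w)"
    proof -
      have *: "?G w = (\<Sum>k<n. z ^ k * hankel_kernel \<kappa> (b - real k) w) + ?R n w"
        if "w \<in> log_contour c \<theta>" for w
      proof -
        let ?x = "z * exp (- w)"
        have x: "?x \<noteq> 1" using ratio[OF that] q by auto
        have "(\<Sum>k<n. z ^ k * hankel_kernel \<kappa> (b - real k) w) = ?K w * (\<Sum>k<n. ?x ^ k)"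
          unfolding hankel_kernel_diff_nat by (simp add: sum_distrib_left power_mult_distrib mult_ac)
        also have "\<dots> = ?K w * ((1 - ?x ^ n) / (1 - ?x))" using x by (simp add: sum_gp_strict)
        also have "\<dots> + ?R n w = (?K w * (1 - ?x ^ n) + ?x ^ n * ?K w) / (1 - ?x)"
          unfolding G_eq by (simp add: add_divide_distrib)
        also have "?K w * (1 - ?x ^ n) + ?x ^ n * ?K w = ?K w"
          by (simp only: right_diff_distrib mult_1_right mult.commute[of "?x ^ n"] diff_add_cancel)
        also have "?K w / (1 - ?x) = ?G w" by (rule G_eq[symmetric])
        finally show ?thesis by simp
      qed
      show ?thesis by (rule hankel_integral_cong[OF \<theta> *])
    qed
    also have "\<dots> = ?S n + hankel_integral c \<theta> (?R n)"
      using \<kappa> by (subst hankel_integral_add) (simp_all add: R_int hankel_integrable_sum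
          hankel_integrable_cmult hankel_integrable_kernel hankel_integral_cmult)
    finally show ?thesis by simp
  qed
  have "(\<lambda>n. hankel_integral c \<theta> ?G - ?S n) \<longlonglongrightarrow> 0"
  proof (rule Lim_null_comparison)
    show "eventually (\<lambda>n. norm (hankel_integral c \<theta> ?G - ?S n) \<le> q ^ n / (1 - q) * ?V) sequentially"
      unfolding split
    proof (intro always_eventually allI)
      fix n
      have "norm (hankel_integral c \<theta> (?R n))
          \<le> hankel_length_integral c \<theta> (\<lambda>w. q ^ n / (1 - q) * norm (?K w))"
        by (rule hankel_integral_norm_le[OF R_int V_int \<theta> R_le])
      also have "\<dots> = q ^ n / (1 - q) * ?V"
        by (rule hankel_length_integral_cmult)
      finally show "norm (hankel_integral c \<theta> (?R n)) \<le> q ^ n / (1 - q) * ?V" .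
    qed
    have "(\<lambda>n. q ^ n) \<longlonglongrightarrow> 0" using q by (intro LIMSEQ_realpow_zero) auto
    thus "(\<lambda>n. q ^ n / (1 - q) * ?V) \<longlonglongrightarrow> 0"
      using tendsto_mult_left[of "\<lambda>n. q ^ n" 0 sequentially "?V / (1 - q)"] by (simp add: mult_ac)
  qed
  hence "(\<lambda>n. hankel_integral c \<theta> ?G - (hankel_integral c \<theta> ?G - ?S n)) \<longlonglongrightarrow> hankel_integral c \<theta> ?G - 0"
    by (intro tendsto_diff tendsto_const)
  thus ?thesis unfolding sums_def by simp
qed

lemma mittag_leffler_hankel_integral_large:
  assumes \<kappa>: "\<kappa> > 0" "pi / 2 < \<kappa> * \<theta>" "\<kappa> * \<theta> < pi" and z: "cmod z < exp c"
  shows "mittag_leffler (1 / \<kappa>) (of_real (1 - b / \<kappa>)) z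
    = \<kappa> / (2 * pi * \<i>) * hankel_integral c \<theta> (ml_kernel \<kappa> b z)"
proof -
  have "(\<lambda>k. \<kappa> / (2 * pi * \<i>) * (z ^ k * hankel_integral c \<theta> (hankel_kernel \<kappa> (b - real k)))) sums
     (\<kappa> / (2 * pi * \<i>) * hankel_integral c \<theta> (ml_kernel \<kappa> b z))"
    by (rule sums_mult[OF ml_kernel_sums[OF assms]])
  moreover have "\<kappa> / (2 * pi * \<i>) * (z ^ k * hankel_integral c \<theta> (hankel_kernel \<kappa> (b - real k)))
     = z ^ k * rGamma (of_real (1 / \<kappa> * real k) + of_real (1 - b / \<kappa>))" for k
  proof -
    \<comment> \<open>This turns the argument of 1/\<Gamma> in Hankel's formula into \<alpha>k +
      \<beta>.\<close>
    have "1 - (b - real k) / \<kappa> = 1 / \<kappa> * real k + (1 - b / \<kappa>)" by (simp add: diff_divide_distrib)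
    hence "complex_of_real (rGamma (1 - (b - real k) / \<kappa>)) = rGamma (of_real (1 / \<kappa> * real k) + of_real (1 - b / \<kappa>))"
      by (simp only: rGamma_complex_of_real of_real_add[symmetric])
    moreover have "\<kappa> / (2 * pi * \<i>) * (z ^ k * (2 * pi * \<i> / \<kappa> * x))
        = (\<kappa> / (2 * pi * \<i>) * (2 * pi * \<i> / \<kappa>)) * (z ^ k * x)" for x :: complex
      by (simp only: mult_ac)
    moreover have "\<kappa> / (2 * pi * \<i>) * (2 * pi * \<i> / \<kappa>) = 1" using \<kappa>(1) by simp
    ultimately show ?thesis unfolding hankel_formula[OF \<kappa>] by simp
  qed
  ultimately show ?thesis unfolding mittag_leffler_def by (simp add: sums_iff)
qed

section \<open>The residue at Ln z and the contraction to radius 1\<close>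

lemma residue_ml_kernel:
  assumes "z \<noteq> 0"
  shows "residue (ml_kernel \<kappa> b z) (Ln z) = hankel_kernel \<kappa> b (Ln z)"
proof (rule residue_simple')
  \<comment> \<open>The strip is centred at Ln z, since for negative z the point Ln z lies on the
    edge of |Im w| < \<pi>. Logarithms of z differ by multiples of 2\<pi>i, so no other one is
    inside.\<close>
  let ?S = "{w. \<bar>Im w - Im (Ln z)\<bar> < pi}"
  have "?S = {w. Im w < Im (Ln z) + pi} \<inter> {w. Im w > Im (Ln z) - pi}" by auto
  thus "open ?S" by (simp add: open_Int open_halfspace_Im_lt open_halfspace_Im_gt)
  show "Ln z \<in> ?S" by simp
  show "ml_kernel \<kappa> b z holomorphic_on ?S - {Ln z}"
  proof (rule holomorphic_on_ml_kernel)
    fix w assume w: "w \<in> ?S - {Ln z}"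
    show "exp w \<noteq> z"
    proof
      assume "exp w = z"
      hence "exp w = exp (Ln z)" using assms by simp
      then obtain n where n: "w = Ln z + (of_int (2 * n) * pi) * \<i>" using exp_eq by blast
      hence "\<bar>of_int (2 * n) * pi\<bar> < 1 * pi" using w by simp
      hence "\<bar>real_of_int (2 * n)\<bar> < 1" unfolding abs_mult by (simp only: abs_of_pos[OF pi_gt_zero] mult_less_cancel_right_pos[OF pi_gt_zero])
      hence "n = 0" by linarith
      thus False using n w by simp
    qed
  qed
  \<comment> \<open>The difference quotient of exp shows that (exp w - z)/(w - Ln z) tends to z, so
    the factor exp w/(exp w - z) has residue 1.\<close>
  have "((\<lambda>w. (exp w - exp (Ln z)) / (w - Ln z)) \<longlongrightarrow> exp (Ln z)) (at (Ln z))"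
    using DERIV_exp[of "Ln z"] unfolding has_field_derivative_iff .
  hence d: "((\<lambda>w. inverse ((exp w - z) / (w - Ln z))) \<longlongrightarrow> inverse z) (at (Ln z))"
    using assms by (intro tendsto_inverse) auto
  have "((\<lambda>w. hankel_kernel \<kappa> b w * exp w * inverse ((exp w - z) / (w - Ln z)))
      \<longlongrightarrow> hankel_kernel \<kappa> b (Ln z) * exp (Ln z) * inverse z) (at (Ln z))"
    by (intro tendsto_mult d isCont_tendsto_compose[OF DERIV_isCont[OF hankel_kernel_DERIV]]
        tendsto_exp tendsto_ident_at)
  also have "hankel_kernel \<kappa> b (Ln z) * exp (Ln z) * inverse z = hankel_kernel \<kappa> b (Ln z)"
    using assms by simp
  finally show "((\<lambda>w. ml_kernel \<kappa> b z w * (w - Ln z)) \<longlongrightarrow> hankel_kernel \<kappa> b (Ln z)) (at (Ln z))"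
    by (simp add: ml_kernel_def divide_inverse mult_ac)
qed

lemma open_convex_strip: "open {w::complex. \<bar>Im w\<bar> < r}" "convex {w::complex. \<bar>Im w\<bar> < r}"
proof -
  have *: "{w::complex. \<bar>Im w\<bar> < r} = {w. Im w < r} \<inter> {w. Im w > - r}" by auto
  show "open {w::complex. \<bar>Im w\<bar> < r}"
    unfolding * by (intro open_Int open_halfspace_Im_lt open_halfspace_Im_gt)
  show "convex {w::complex. \<bar>Im w\<bar> < r}"
    unfolding * by (intro convex_Int convex_halfspace_Im_lt convex_halfspace_Im_gt)
qed

text \<open>The representation at a radius exp c > |z| is contracted to radius 1 < |z|. The
  rectangle in between has Ln z in its interior if |Arg z| < \<theta> and contains no logarithm of z
  if |Arg z| > \<theta>; |Arg z| \<noteq> \<theta> keeps the pole off the rays.\<close>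

lemma mittag_leffler_hankel_integral:
  assumes \<kappa>: "\<kappa> > 0" "pi / 2 < \<kappa> * \<theta>" "\<kappa> * \<theta> < pi" and \<theta>: "\<theta> < pi"
    and z: "cmod z > 1" "\<bar>Arg z\<bar> \<noteq> \<theta>" and int: "hankel_integrable 0 \<theta> (ml_kernel \<kappa> b z)"
  shows "mittag_leffler (1 / \<kappa>) (of_real (1 - b / \<kappa>)) z
    = \<kappa> / (2 * pi * \<i>) * hankel_integral 0 \<theta> (ml_kernel \<kappa> b z)
      + (if \<bar>Arg z\<bar> < \<theta> then \<kappa> * hankel_kernel \<kappa> b (Ln z) else 0)"
proof -
  define c where "c = ln (cmod z) + 1"
  have z0: "z \<noteq> 0" using z by auto
  have c: "cmod z < exp c" "0 < c" "ln (cmod z) < c"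
    using z z0 by (simp_all add: c_def exp_add add_pos_pos)
  have "0 < \<kappa> * \<theta>" using \<kappa> pi_half_gt_zero by linarith
  hence \<theta>0: "\<theta> > 0" using \<kappa>(1) by (simp add: zero_less_mult_iff)
  have Ln_eq: "w = Ln z" if "exp w = z" "\<bar>Im w\<bar> < pi" for w
    using that Ln_exp[of w] by auto
  note shift = hankel_integral_shift[OF int c(2)]
  have "hankel_integral c \<theta> (ml_kernel \<kappa> b z) - hankel_integral 0 \<theta> (ml_kernel \<kappa> b z)
      = (if \<bar>Arg z\<bar> < \<theta> then 2 * pi * \<i> * hankel_kernel \<kappa> b (Ln z) else 0)"
  proof (cases "\<bar>Arg z\<bar> < \<theta>")
    case True
    have "Ln z \<in> box (Complex 0 (- \<theta>)) (Complex c \<theta>)"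
      using True z z0 c by (auto simp: in_box_complex_iff Arg_eq_Im_Ln[symmetric])
    moreover have "cbox (Complex 0 (- \<theta>)) (Complex c \<theta>) \<subseteq> {w. \<bar>Im w\<bar> < pi}"
      using \<theta> by (auto simp: in_cbox_complex_iff)
    moreover have "ml_kernel \<kappa> b z holomorphic_on {w. \<bar>Im w\<bar> < pi} - {Ln z}"
      by (rule holomorphic_on_ml_kernel) (use Ln_eq in auto)
    ultimately show ?thesis
      using rectangle_integral_residue[OF c(2), of "- \<theta>" \<theta> "ml_kernel \<kappa> b z" "{w. \<bar>Im w\<bar> < pi}" "Ln z"]
        True \<theta>0 residue_ml_kernel[OF z0, of \<kappa> b] open_convex_strip[of pi] shift by simp
  next
    case False
    \<comment> \<open>The open strip of half-width |Arg z| \<le> \<pi> contains the rectangle and is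
      free of poles, Ln z itself being on its edge.\<close>
    have "cbox (Complex 0 (- \<theta>)) (Complex c \<theta>) \<subseteq> {w. \<bar>Im w\<bar> < \<bar>Arg z\<bar>}"
      using False z by (auto simp: in_cbox_complex_iff)
    moreover have "ml_kernel \<kappa> b z holomorphic_on {w. \<bar>Im w\<bar> < \<bar>Arg z\<bar>}"
    proof (rule holomorphic_on_ml_kernel)
      fix w assume w: "w \<in> {w. \<bar>Im w\<bar> < \<bar>Arg z\<bar>}"
      have "\<bar>Arg z\<bar> \<le> pi" using Arg_bounded[of z] by auto
      thus "exp w \<noteq> z" using w Ln_eq[of w] z0 by (auto simp: Arg_eq_Im_Ln)
    qed
    ultimately show ?thesis
      using rectangle_integral_eq_0[OF c(2), of "- \<theta>" \<theta> "ml_kernel \<kappa> b z" "{w. \<bar>Im w\<bar> < \<bar>Arg z\<bar>}"]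
        False \<theta>0 open_convex_strip[of "\<bar>Arg z\<bar>"] shift by simp
  qed
  hence "hankel_integral c \<theta> (ml_kernel \<kappa> b z) = hankel_integral 0 \<theta> (ml_kernel \<kappa> b z)
      + (if \<bar>Arg z\<bar> < \<theta> then 2 * pi * \<i> * hankel_kernel \<kappa> b (Ln z) else 0)"
    by (simp add: algebra_simps)
  thus ?thesis
    unfolding mittag_leffler_hankel_integral_large[OF \<kappa> c(1)] by (simp add: algebra_simps)
qed

section \<open>Estimates of the integral over the contour\<close>

lemma hankel_integrable_ml_kernel:
  assumes \<kappa>: "\<kappa> > 0" "pi / 2 < \<kappa> * \<theta>" "\<kappa> * \<theta> \<le> pi"
    and "\<delta> > 0" "\<And>w. w \<in> log_contour c \<theta> \<Longrightarrow> \<delta> \<le> norm (exp w - z)"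
  shows "hankel_integrable c \<theta> (ml_kernel \<kappa> b z)"
proof (rule hankel_integrable_kernel_bounded[OF \<kappa>])
  have ne: "exp w \<noteq> z" if "w \<in> log_contour c \<theta>" for w
    using assms(4) assms(5)[OF that] by auto
  show "continuous_on (log_contour c \<theta>) (ml_kernel \<kappa> b z)"
    by (rule continuous_on_ml_kernel) (rule ne)
  show "norm (ml_kernel \<kappa> b z w) \<le> (1 + norm z / \<delta>) * norm (hankel_kernel \<kappa> b w)"
    if "w \<in> log_contour c \<theta>" for w
  proof -
    \<comment> \<open>Since exp w is unbounded on the contour, the fraction is split so that the
      lower bound \<delta> alone controls it.\<close>
    have "exp w / (exp w - z) = 1 + z / (exp w - z)" using ne[OF that] by (simp add: field_simps)
    also have "norm \<dots> \<le> 1 + norm z / norm (exp w - z)"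
      by (rule order.trans[OF norm_triangle_ineq]) (simp add: norm_divide)
    also have "\<dots> \<le> 1 + norm z / \<delta>"
      using assms(4) assms(5)[OF that] by (intro add_left_mono divide_left_mono mult_pos_pos) auto
    finally show ?thesis unfolding ml_kernel_def norm_mult
      by (subst mult.commute) (rule mult_right_mono, auto)
  qed
qed (use assms in auto)

lemma hankel_integrable_norm_kernel_exp:
  assumes "\<kappa> > 0" "pi / 2 < \<kappa> * \<theta>" "\<kappa> * \<theta> \<le> pi"
  shows "hankel_integrable c \<theta> (\<lambda>w. k * (norm (hankel_kernel \<kappa> b w) * norm (exp w)))"
proof -
  \<comment> \<open>The factor |exp w| raises the exponent b by one, so the decay of the kernel
    applies again.\<close>
  have "norm (hankel_kernel \<kappa> b w) * exp (Re w) = norm (hankel_kernel \<kappa> (b + 1) w)" for w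
    by (simp add: norm_hankel_kernel mult_exp_exp algebra_simps)
  thus ?thesis
    by (intro hankel_integrable_kernel_bounded[OF assms, where C = "\<bar>k\<bar>" and a = "b + 1"])
       (auto simp: abs_mult intro!: continuous_intros)
qed

lemma norm_hankel_integral_ml_kernel_le:
  assumes \<kappa>: "\<kappa> > 0" "pi / 2 < \<kappa> * \<theta>" "\<kappa> * \<theta> \<le> pi"
    and \<delta>: "\<delta> > 0" "\<And>w. w \<in> log_contour c \<theta> \<Longrightarrow> \<delta> \<le> norm (exp w - z)"
  shows "norm (hankel_integral c \<theta> (ml_kernel \<kappa> b z))
    \<le> hankel_length_integral c \<theta> (\<lambda>w. norm (hankel_kernel \<kappa> b w) * norm (exp w)) / \<delta>"
proof -
  let ?g = "\<lambda>w. norm (hankel_kernel \<kappa> b w) * norm (exp w)"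
  have "norm (hankel_integral c \<theta> (ml_kernel \<kappa> b z)) \<le> hankel_length_integral c \<theta> (\<lambda>w. 1 / \<delta> * ?g w)"
  proof (rule hankel_integral_norm_le)
    have "0 < \<kappa> * \<theta>" using \<kappa> pi_half_gt_zero by linarith
    thus "\<theta> \<ge> 0" using \<kappa>(1) by (simp add: zero_less_mult_iff)
    show "hankel_integrable c \<theta> (ml_kernel \<kappa> b z)"
      by (rule hankel_integrable_ml_kernel[OF assms])
    show "hankel_integrable c \<theta> (\<lambda>w. 1 / \<delta> * ?g w)"
      by (rule hankel_integrable_norm_kernel_exp[OF \<kappa>])
    show "norm (ml_kernel \<kappa> b z w) \<le> 1 / \<delta> * ?g w" if "w \<in> log_contour c \<theta>" for w
      unfolding ml_kernel_def norm_mult norm_divide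
      using \<delta>(1) \<delta>(2)[OF that] by (auto simp: divide_simps intro!: mult_left_mono)
  qed
  thus ?thesis unfolding hankel_length_integral_cmult by simp
qed

text \<open>A factor exp w raises the exponent \<kappa> - 1 to \<kappa>, and the term -1/z of the
  partial fraction integrates to a multiple of 1/\<Gamma>(0). The factor 1/z left over is the source
  of the exponent \<alpha> + 1 in the final bounds for \<beta> = \<alpha>.\<close>

lemma hankel_integral_ml_kernel_kappa_minus_1:
  assumes \<kappa>: "\<kappa> > 0" "pi / 2 < \<kappa> * \<theta>" "\<kappa> * \<theta> < pi" and "z \<noteq> 0"
    and "\<delta> > 0" "\<And>w. w \<in> log_contour c \<theta> \<Longrightarrow> \<delta> \<le> norm (exp w - z)"
  shows "hankel_integral c \<theta> (ml_kernel \<kappa> (\<kappa> - 1) z) = hankel_integral c \<theta> (ml_kernel \<kappa> \<kappa> z) / z"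
proof -
  have \<kappa>': "\<kappa> * \<theta> \<le> pi" using \<kappa> by simp
  have "0 < \<kappa> * \<theta>" using \<kappa> pi_half_gt_zero by linarith
  hence \<theta>: "\<theta> \<ge> 0" using \<kappa>(1) by (simp add: zero_less_mult_iff)
  have eq: "ml_kernel \<kappa> (\<kappa> - 1) z w = - 1 / z * hankel_kernel \<kappa> \<kappa> w + 1 / z * ml_kernel \<kappa> \<kappa> z w"
    if "w \<in> log_contour c \<theta>" for w
  proof -
    have "exp w - z \<noteq> 0" using assms(5) assms(6)[OF that] by auto
    hence "- 1 / z * K + 1 / z * (K * (exp w / (exp w - z))) = K / (exp w - z)" for K
      using assms(4) by (simp add: divide_simps) (simp add: algebra_simps)
    moreover have "hankel_kernel \<kappa> (\<kappa> - 1) w * exp w = hankel_kernel \<kappa> \<kappa> w"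
      by (simp add: hankel_kernel_def mult_exp_exp algebra_simps)
    hence "ml_kernel \<kappa> (\<kappa> - 1) z w = hankel_kernel \<kappa> \<kappa> w / (exp w - z)"
      unfolding ml_kernel_def by simp
    ultimately show ?thesis unfolding ml_kernel_def by simp
  qed
  have "hankel_integral c \<theta> (ml_kernel \<kappa> (\<kappa> - 1) z)
      = hankel_integral c \<theta> (\<lambda>w. - 1 / z * hankel_kernel \<kappa> \<kappa> w + 1 / z * ml_kernel \<kappa> \<kappa> z w)"
    by (rule hankel_integral_cong[OF \<theta> eq])
  also have "\<dots> = - 1 / z * hankel_integral c \<theta> (hankel_kernel \<kappa> \<kappa>) + 1 / z * hankel_integral c \<theta> (ml_kernel \<kappa> \<kappa> z)"
    by (subst hankel_integral_add; (intro hankel_integrable_cmult hankel_integrable_kernel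
        hankel_integrable_ml_kernel[OF \<kappa>(1,2) \<kappa>' assms(5,6)] \<kappa> \<kappa>')?; simp only: hankel_integral_cmult)
  also have "hankel_integral c \<theta> (hankel_kernel \<kappa> \<kappa>) = 0"
    unfolding hankel_formula[OF \<kappa>] using \<kappa>(1) by simp
  finally show ?thesis by simp
qed

subsection \<open>Arc length integrals along the Hankel contour\<close>

lemma continuous_on_hankel_contour: "continuous_on UNIV (hankel_contour 1 \<theta>)" if "\<theta> > 0"
proof -
  let ?A = "{..- \<theta>}" and ?B = "{- \<theta>..\<theta>}" and ?C = "{\<theta>..}"
  have "continuous_on ?A (hankel_contour 1 \<theta>)"
    using that by (subst continuous_on_cong[OF refl, of _ _ "\<lambda>s. of_real (1 + (- \<theta> - s)) * cis (- \<theta>)"])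
      (auto simp: hankel_contour_def intro!: continuous_intros)
  moreover have "continuous_on ?B (hankel_contour 1 \<theta>)"
    by (subst continuous_on_cong[OF refl, of _ _ cis])
      (auto simp: hankel_contour_def intro!: continuous_intros)
  moreover have "continuous_on ?C (hankel_contour 1 \<theta>)"
    using that by (subst continuous_on_cong[OF refl, of _ _ "\<lambda>s. of_real (1 + (s - \<theta>)) * cis \<theta>"])
      (auto simp: hankel_contour_def intro!: continuous_intros)
  ultimately have "continuous_on (?A \<union> ?B \<union> ?C) (hankel_contour 1 \<theta>)"
    by (intro continuous_on_closed_Un) auto
  moreover have "?A \<union> ?B \<union> ?C = UNIV" by auto
  ultimately show ?thesis by simp
qed

text \<open>For radius 1 the parameter s is arc length on the arc as well as on the rays.\<close>

lemma norm_vector_derivative_hankel_contour: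
  assumes "\<theta> > 0" "s \<noteq> - \<theta>" "s \<noteq> \<theta>"
  shows "norm (vector_derivative (hankel_contour 1 \<theta>) (at s)) = 1"
proof -
  consider "s < - \<theta>" | "- \<theta> < s" "s < \<theta>" | "s > \<theta>" using assms by linarith
  thus ?thesis
  proof cases
    case 1
    have "(hankel_contour 1 \<theta> has_vector_derivative - cis (- \<theta>)) (at s)"
      by (rule has_vector_derivative_transform_within_open[where S = "{..<- \<theta>}"
            and f = "\<lambda>s. of_real (1 + (- \<theta> - s)) * cis (- \<theta>)"])
         (use 1 in \<open>auto simp: hankel_contour_def intro!: derivative_eq_intros\<close>)
    thus ?thesis by (simp add: vector_derivative_at)
  next
    case 2
    have "(cis has_vector_derivative \<i> * cis s) (at s)"
      unfolding cis_conv_exp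
      by (rule has_vector_derivative_real_field[of "\<lambda>z. exp (\<i> * z)"]) (auto intro!: derivative_eq_intros)
    hence "(hankel_contour 1 \<theta> has_vector_derivative \<i> * cis s) (at s)"
      by (rule has_vector_derivative_transform_within_open[where S = "{- \<theta><..<\<theta>}"])
         (use 2 in \<open>auto simp: hankel_contour_def\<close>)
    thus ?thesis by (simp add: vector_derivative_at norm_mult)
  next
    case 3
    have "(hankel_contour 1 \<theta> has_vector_derivative cis \<theta>) (at s)"
      by (rule has_vector_derivative_transform_within_open[where S = "{\<theta><..}"
            and f = "\<lambda>s. of_real (1 + (s - \<theta>)) * cis \<theta>"])
         (use 3 assms in \<open>auto simp: hankel_contour_def intro!: derivative_eq_intros\<close>)
    thus ?thesis by (simp add: vector_derivative_at)
  qed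
qed

lemma exp_Complex: "exp (Complex x y) = of_real (exp x) * cis y"
  by (simp add: exp_eq_polar)

lemma arc_length_integral_hankel_contour:
  fixes f :: "complex \<Rightarrow> real"
  assumes \<theta>: "\<theta> > 0" and cont: "continuous_on UNIV (\<lambda>s. f (hankel_contour 1 \<theta> s))"
    and int: "hankel_integrable 0 \<theta> (\<lambda>w. f (exp w) * norm (exp w))"
  shows "arc_length_integral (hankel_contour 1 \<theta>) f
    = hankel_length_integral 0 \<theta> (\<lambda>w. f (exp w) * norm (exp w))"
proof -
  let ?\<gamma> = "hankel_contour 1 \<theta>"
  define F where "F s = f (?\<gamma> s)" for s
  have F_meas: "F \<in> borel_measurable borel"
    unfolding F_def using cont by (rule borel_measurable_continuous_onI)
  let ?h = "\<lambda>s. f (?\<gamma> s) * norm (vector_derivative ?\<gamma> (at s))"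
  have h_eq: "?h s = F s" if "s \<notin> {- \<theta>, \<theta>}" for s
    using norm_vector_derivative_hankel_contour[OF \<theta>, of s] that by (simp add: F_def)
  have h_meas: "?h \<in> borel_measurable borel"
    by (rule measurable_discrete_difference[OF F_meas, of "{- \<theta>, \<theta>}"]) (use h_eq in auto)
  have "AE s in lborel. ?h s = F s"
    using AE_lborel_singleton[of "- \<theta>"] AE_lborel_singleton[of \<theta>]
    by eventually_elim (use h_eq in auto)
  hence "arc_length_integral ?\<gamma> f = integral\<^sup>L lborel F"
    unfolding arc_length_integral_def using F_meas h_meas by (intro integral_cong_AE) auto
  also have "\<dots> = integral\<^sup>L lebesgue F"
    using F_meas by (intro integral_completion[symmetric]) auto
  finally have arc: "arc_length_integral ?\<gamma> f = integral\<^sup>L lebesgue F" .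

  \<comment> \<open>The point of modulus exp x on the upper ray has parameter s = \<theta> + exp x -
    1, because the ray starts with modulus 1 at s = \<theta>. The lower ray is the mirror
    image.\<close>
  have R_im: "(\<lambda>x. \<theta> + exp x - 1) ` {0..} = {\<theta>..}"
  proof (intro equalityI subsetI)
    fix s assume "s \<in> {\<theta>..}"
    thus "s \<in> (\<lambda>x. \<theta> + exp x - 1) ` {0..}"
      by (intro image_eqI[of _ _ "ln (s - \<theta> + 1)"]) auto
  qed auto
  have L_im: "(\<lambda>x. - \<theta> - exp x + 1) ` {0..} = {..- \<theta>}"
  proof (intro equalityI subsetI)
    fix s assume "s \<in> {..- \<theta>}"
    thus "s \<in> (\<lambda>x. - \<theta> - exp x + 1) ` {0..}"
      by (intro image_eqI[of _ _ "ln (- \<theta> - s + 1)"]) auto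
  qed auto
  have R_eq: "f (exp (Complex x \<theta>)) * norm (exp (Complex x \<theta>)) = \<bar>exp x\<bar> * F (\<theta> + exp x - 1)"
    if "x \<ge> 0" for x
  proof -
    \<comment> \<open>At y = 0 the definition of the contour uses the arc clause, which agrees with
      the ray there.\<close>
    have "F (\<theta> + y) = f (of_real (1 + y) * cis \<theta>)" if "y \<ge> 0" for y
      using that \<theta> by (cases "y = 0") (auto simp: F_def hankel_contour_def)
    from this[of "exp x - 1"] show ?thesis using that by (simp add: exp_Complex norm_mult add_diff_eq)
  qed
  have L_eq: "f (exp (Complex x (- \<theta>))) * norm (exp (Complex x (- \<theta>))) = \<bar>- exp x\<bar> * F (- \<theta> - exp x + 1)"
    if "x \<ge> 0" for x
    using that \<theta> by (cases "x = 0") (auto simp: F_def exp_Complex hankel_contour_def norm_mult)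
  have M_eq: "f (exp (Complex 0 y)) * norm (exp (Complex 0 y)) = F y" if "y \<in> {- \<theta>..\<theta>}" for y
    using that by (auto simp: F_def exp_Complex hankel_contour_def)

  let ?g = "\<lambda>w. f (exp w) * norm (exp w)"
  have cv_R: "(\<lambda>x. \<bar>exp x\<bar> * F (\<theta> + exp x - 1)) absolutely_integrable_on {0..} \<and>
      integral {0..} (\<lambda>x. \<bar>exp x\<bar> * F (\<theta> + exp x - 1)) = b
    \<longleftrightarrow> F absolutely_integrable_on {\<theta>..} \<and> integral {\<theta>..} F = b" for b
    unfolding R_im[symmetric]
    by (rule has_absolute_integral_change_of_variables_1')
       (auto simp: inj_on_def intro!: derivative_eq_intros)
  have "(\<lambda>x. \<bar>exp x\<bar> * F (\<theta> + exp x - 1)) absolutely_integrable_on {0..}"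
    using int unfolding hankel_integrable_def
    by (subst set_integrable_cong[OF refl refl R_eq[symmetric]]) auto
  moreover have "integral {0..} (\<lambda>x. \<bar>exp x\<bar> * F (\<theta> + exp x - 1)) = integral {0..} (\<lambda>x. ?g (Complex x \<theta>))"
    by (intro Henstock_Kurzweil_Integration.integral_cong R_eq[symmetric]) auto
  ultimately have R: "F absolutely_integrable_on {\<theta>..}"
      "integral {\<theta>..} F = integral {0..} (\<lambda>x. ?g (Complex x \<theta>))"
    using cv_R by blast+

  have cv_L: "(\<lambda>x. \<bar>- exp x\<bar> * F (- \<theta> - exp x + 1)) absolutely_integrable_on {0..} \<and>
      integral {0..} (\<lambda>x. \<bar>- exp x\<bar> * F (- \<theta> - exp x + 1)) = b
    \<longleftrightarrow> F absolutely_integrable_on {..- \<theta>} \<and> integral {..- \<theta>} F = b" for b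
    unfolding L_im[symmetric]
    by (rule has_absolute_integral_change_of_variables_1')
       (auto simp: inj_on_def intro!: derivative_eq_intros)
  have "(\<lambda>x. \<bar>- exp x\<bar> * F (- \<theta> - exp x + 1)) absolutely_integrable_on {0..}"
    using int unfolding hankel_integrable_def
    by (subst set_integrable_cong[OF refl refl L_eq[symmetric]]) auto
  moreover have "integral {0..} (\<lambda>x. \<bar>- exp x\<bar> * F (- \<theta> - exp x + 1)) = integral {0..} (\<lambda>x. ?g (Complex x (- \<theta>)))"
    by (intro Henstock_Kurzweil_Integration.integral_cong L_eq[symmetric]) auto
  ultimately have L: "F absolutely_integrable_on {..- \<theta>}"
      "integral {..- \<theta>} F = integral {0..} (\<lambda>x. ?g (Complex x (- \<theta>)))"
    using cv_L by blast+

  have M: "F absolutely_integrable_on {- \<theta>..\<theta>}"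
    unfolding F_def by (intro absolutely_integrable_continuous_real continuous_on_subset[OF cont]) auto
  have M': "integral {- \<theta>..\<theta>} F = integral {- \<theta>..\<theta>} (\<lambda>y. ?g (Complex 0 y))"
    by (intro Henstock_Kurzweil_Integration.integral_cong M_eq[symmetric]) auto

  have U: "{..- \<theta>} \<union> {- \<theta>..\<theta>} = {..\<theta>}" "{..\<theta>} \<union> {\<theta>..} = UNIV"
    "{..- \<theta>} \<inter> {- \<theta>..\<theta>} = {- \<theta>}" "{..\<theta>} \<inter> {\<theta>..} = {\<theta>}" using \<theta> by auto
  have LM: "F absolutely_integrable_on {..\<theta>}"
    using absolutely_integrable_Un[OF L(1) M] U by simp
  have LMR: "F absolutely_integrable_on UNIV"
    using absolutely_integrable_Un[OF LM R(1)] U by simp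
  have i: "F integrable_on {..- \<theta>}" "F integrable_on {- \<theta>..\<theta>}" "F integrable_on {..\<theta>}" "F integrable_on {\<theta>..}"
    using L(1) M LM R(1) by (simp_all add: absolutely_integrable_on_def)
  have "integral UNIV F = integral {..\<theta>} F + integral {\<theta>..} F"
    using Henstock_Kurzweil_Integration.integral_Un[OF i(3,4)] U by simp
  also have "integral {..\<theta>} F = integral {..- \<theta>} F + integral {- \<theta>..\<theta>} F"
    using Henstock_Kurzweil_Integration.integral_Un[OF i(1,2)] U by simp
  finally have "integral UNIV F = hankel_length_integral 0 \<theta> ?g"
    unfolding hankel_length_integral_def R(2) L(2) M' by simp
  moreover have "integral UNIV F = integral\<^sup>L lebesgue F"
    using set_lebesgue_integral_eq_integral(2)[OF LMR] by (simp add: set_lebesgue_integral_def)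
  ultimately show ?thesis using arc by simp
qed

section \<open>Principal powers on the contour\<close>

lemma hankel_contour_notin_nonpos_Reals:
  assumes "0 < \<theta>" "\<theta> < pi"
  shows "hankel_contour 1 \<theta> s \<notin> \<real>\<^sub>\<le>\<^sub>0"
proof -
  obtain r \<phi> where r: "r > 0" "\<bar>\<phi>\<bar> \<le> \<theta>" "hankel_contour 1 \<theta> s = of_real r * cis \<phi>"
  proof (cases "s < - \<theta>")
    case True
    thus ?thesis using assms that[of "1 + (- \<theta> - s)" "- \<theta>"] by (simp add: hankel_contour_def)
  next
    case False
    thus ?thesis
      using assms that[of 1 s] that[of "1 + (s - \<theta>)" \<theta>] by (cases "s \<le> \<theta>") (auto simp: hankel_contour_def)
  qed
  have "Arg (of_real r * cis \<phi>) = \<phi>"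
    using r(1,2) assms by (subst Arg_times_of_real) (auto intro!: Arg_cis)
  moreover have "of_real r * cis \<phi> \<noteq> 0" using r by simp
  moreover have "z \<notin> \<real>\<^sub>\<le>\<^sub>0" if "z \<noteq> 0" "Arg z \<noteq> pi" for z
    using that by (auto simp: complex_nonpos_Reals_iff Arg_eq_pi complex_eq_iff)
  ultimately show ?thesis
    using r(2) assms unfolding r(3) by fastforce
qed

text \<open>Since |Im w| \<le> \<theta> < \<pi> on the contour, Ln(exp w) = w and the principal
  power of \<zeta> = exp w is exp(\<kappa> w). The contour avoids the cut, so this power is
  continuous along it. F is left open because two such integrals are needed for m.\<close>

lemma arc_length_integral_powr:
  fixes F :: "complex \<Rightarrow> real"
  assumes \<theta>: "0 < \<theta>" "\<theta> < pi" and F: "continuous_on UNIV F"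
    and int: "hankel_integrable 0 \<theta> (\<lambda>w. F (exp (of_real \<kappa> * w)) * norm (exp w))"
  shows "arc_length_integral (hankel_contour 1 \<theta>) (\<lambda>\<zeta>. F (\<zeta> powr of_real \<kappa>))
    = hankel_length_integral 0 \<theta> (\<lambda>w. F (exp (of_real \<kappa> * w)) * norm (exp w))"
proof -
  have eq: "F (exp w powr of_real \<kappa>) * norm (exp w) = F (exp (of_real \<kappa> * w)) * norm (exp w)"
    if "w \<in> log_contour 0 \<theta>" for w
  proof -
    have "\<bar>Im w\<bar> \<le> \<theta>" using that by (auto simp: log_contour_def)
    hence "Ln (exp w) = w" using \<theta> by (intro Ln_exp) auto
    thus ?thesis by (simp add: powr_def)
  qed
  have "continuous_on UNIV (\<lambda>s. exp (of_real \<kappa> * Ln (hankel_contour 1 \<theta> s)))"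
    by (intro continuous_intros continuous_on_hankel_contour \<theta> hankel_contour_notin_nonpos_Reals)
  moreover have "exp (of_real \<kappa> * Ln (hankel_contour 1 \<theta> s)) = hankel_contour 1 \<theta> s powr of_real \<kappa>" for s
    using hankel_contour_notin_nonpos_Reals[OF \<theta>, of s] by (auto simp: powr_def)
  ultimately have "continuous_on UNIV (\<lambda>s. F (hankel_contour 1 \<theta> s powr of_real \<kappa>))"
    using continuous_on_compose2[OF F] by simp
  moreover have "hankel_integrable 0 \<theta> (\<lambda>w. F (exp w powr of_real \<kappa>) * norm (exp w))"
    using int \<theta> by (subst hankel_integrable_cong[OF _ eq]) auto
  ultimately have "arc_length_integral (hankel_contour 1 \<theta>) (\<lambda>\<zeta>. F (\<zeta> powr of_real \<kappa>))
      = hankel_length_integral 0 \<theta> (\<lambda>w. F (exp w powr of_real \<kappa>) * norm (exp w))"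
    using \<theta> by (intro arc_length_integral_hankel_contour)
  also have "\<dots> = hankel_length_integral 0 \<theta> (\<lambda>w. F (exp (of_real \<kappa> * w)) * norm (exp w))"
    using \<theta> by (intro hankel_length_integral_cong eq) auto
  finally show ?thesis .
qed

subsection \<open>The estimates\<close>

text \<open>The distance from a point of modulus \<rho> to a ray that makes an angle of at least
  \<open>\<theta>\<^sub>0\<close> with it: by the law of cosines its square exceeds the square of
  \<open>\<rho> * sin \<theta>\<^sub>0\<close> by at least that of
  \<open>r - \<rho> * cos \<theta>\<^sub>0\<close>. Stating the angle through its cosine spares a
  normalization modulo 2\<pi>.\<close>

lemma norm_ray_diff_ge:
  fixes r \<rho> \<phi> \<psi> \<theta>\<^sub>0 :: real
  assumes "r \<ge> 0" "\<rho> \<ge> 0" "cos (\<phi> - \<psi>) \<le> cos \<theta>\<^sub>0" "0 \<le> sin \<theta>\<^sub>0"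
  shows "\<rho> * sin \<theta>\<^sub>0 \<le> norm (of_real r * cis \<phi> - of_real \<rho> * cis \<psi>)"
proof (rule power2_le_imp_le)
  have "r * \<rho> * cos (\<phi> - \<psi>) \<le> r * \<rho> * cos \<theta>\<^sub>0"
    using assms by (intro mult_left_mono) auto
  moreover have "(norm (of_real r * cis \<phi> - of_real \<rho> * cis \<psi>))\<^sup>2
      = r\<^sup>2 * ((cos \<phi>)\<^sup>2 + (sin \<phi>)\<^sup>2) + \<rho>\<^sup>2 * ((cos \<psi>)\<^sup>2 + (sin \<psi>)\<^sup>2) - 2 * (r * \<rho> * cos (\<phi> - \<psi>))"
  proof -
    have "(norm (of_real r * cis \<phi> - of_real \<rho> * cis \<psi>))\<^sup>2
        = (r * cos \<phi> - \<rho> * cos \<psi>)\<^sup>2 + (r * sin \<phi> - \<rho> * sin \<psi>)\<^sup>2"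
      by (simp add: cmod_power2)
    thus ?thesis unfolding cos_diff by algebra
  qed
  moreover have "(r - \<rho> * cos \<theta>\<^sub>0)\<^sup>2 = r\<^sup>2 + \<rho>\<^sup>2 * (cos \<theta>\<^sub>0)\<^sup>2 - 2 * (r * \<rho> * cos \<theta>\<^sub>0)"
    by (simp add: power2_eq_square algebra_simps)
  moreover have "\<rho>\<^sup>2 * (cos \<theta>\<^sub>0)\<^sup>2 = \<rho>\<^sup>2 - (\<rho> * sin \<theta>\<^sub>0)\<^sup>2"
    by (simp add: cos_squared_eq power_mult_distrib algebra_simps)
  moreover have "0 \<le> (r - \<rho> * cos \<theta>\<^sub>0)\<^sup>2" by simp
  ultimately show "(\<rho> * sin \<theta>\<^sub>0)\<^sup>2 \<le> (norm (of_real r * cis \<phi> - of_real \<rho> * cis \<psi>))\<^sup>2"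
    by simp
qed simp

text \<open>On the arc the distance is at least |z| - 1, and the hypothesis on |z| says exactly that
  this is no less than \<open>cmod z * sin \<theta>\<^sub>0\<close>. On the rays the distance of z
  from a ray is used.\<close>

lemma norm_exp_diff_log_contour_ge:
  assumes \<theta>: "0 < \<theta>" "\<theta> < pi" and \<theta>\<^sub>0: "0 < \<theta>\<^sub>0" "\<theta>\<^sub>0 < pi / 2" "\<theta>\<^sub>0 \<le> \<theta>"
    and sep: "\<bar>\<theta> - \<bar>Arg z\<bar>\<bar> \<ge> \<theta>\<^sub>0" and z: "cmod z * (1 - sin \<theta>\<^sub>0) \<ge> 1"
    and w: "w \<in> log_contour 0 \<theta>"
  shows "cmod z * sin \<theta>\<^sub>0 \<le> norm (exp w - z)"
proof (cases "Re w = 0")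
  case True
  hence "norm (exp w) = 1" by simp
  thus ?thesis using z norm_triangle_ineq3[of "exp w" z] by (simp add: algebra_simps abs_if split: if_splits)
next
  case False
  hence Im: "\<bar>Im w\<bar> = \<theta>" using w by (auto simp: log_contour_def)
  have A: "- pi < Arg z" "Arg z \<le> pi" using Arg_bounded by auto
  have sin: "sin \<theta>\<^sub>0 \<ge> 0" using \<theta>\<^sub>0 by (intro sin_ge_zero) auto
  \<comment> \<open>The angle |Im w - Arg z| may exceed \<pi>. The gap between \<theta> and |Arg z|
    confines it to \<open>{\<theta>\<^sub>0..2 * pi - \<theta>\<^sub>0}\<close>, and the cosine is
    symmetric about \<pi>.\<close>
  have c: "cos x \<le> cos \<theta>\<^sub>0" if "\<theta>\<^sub>0 \<le> x" "x \<le> 2 * pi - \<theta>\<^sub>0" for x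
  proof (cases "x \<le> pi")
    case True
    thus ?thesis using that \<theta>\<^sub>0 by (intro cos_monotone_0_pi_le) auto
  next
    case False
    have "cos x = cos (2 * pi - x)" by (simp add: cos_diff)
    also have "\<dots> \<le> cos \<theta>\<^sub>0" using that \<theta>\<^sub>0 False by (intro cos_monotone_0_pi_le) auto
    finally show ?thesis .
  qed
  have d: "cos (Im w - Arg z) \<le> cos \<theta>\<^sub>0"
  proof -
    have "cos (Im w - Arg z) = cos \<bar>Im w - Arg z\<bar>" by (simp add: abs_if cos_diff)
    also have "\<dots> \<le> cos \<theta>\<^sub>0"
      by (rule c) (use Im A \<theta> \<theta>\<^sub>0 sep in linarith)+
    finally show ?thesis .
  qed
  have "z = of_real (cmod z) * cis (Arg z)"
    by (metis rcis_cmod_Arg rcis_def)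
  moreover have "exp w = of_real (exp (Re w)) * cis (Im w)" by (simp add: exp_eq_polar)
  ultimately show ?thesis
    using norm_ray_diff_ge[of "exp (Re w)" "cmod z" "Im w" "Arg z" \<theta>\<^sub>0] d sin by simp
qed

theorem lemma2:
  fixes \<alpha> \<theta> \<theta>\<^sub>0 m t\<^sub>0 :: real and lam :: complex
  assumes "0 < \<alpha>" and "\<alpha> < 1"
    and "lam \<noteq> 0"
    and "\<alpha> * pi / 2 < \<theta>" and "\<theta> < \<alpha> * pi"
    and "0 < \<theta>\<^sub>0" and "\<theta>\<^sub>0 < \<theta> - \<alpha> * pi / 2"
    and "\<bar>\<theta> - \<bar>Arg lam\<bar>\<bar> \<ge> \<theta>\<^sub>0"
    and m_eq: "m = max
      (arc_length_integral (hankel_contour 1 \<theta>)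
          (\<lambda>\<zeta>. cmod (exp (\<zeta> powr of_real (1 / \<alpha>))))
        / (2 * \<alpha> * pi * cmod lam * sin \<theta>\<^sub>0))
      (arc_length_integral (hankel_contour 1 \<theta>)
          (\<lambda>\<zeta>. cmod (exp (\<zeta> powr of_real (1 / \<alpha>)) * \<zeta> powr of_real (1 / \<alpha>)))
        / (2 * \<alpha> * (cmod lam)\<^sup>2 * sin \<theta>\<^sub>0))"
    and t0_eq: "t\<^sub>0 = 1 / (cmod lam powr (1 / \<alpha>) * (1 - sin \<theta>\<^sub>0) powr (1 / \<alpha>))"
  shows "(\<bar>Arg lam\<bar> < \<alpha> * pi / 2 \<longrightarrow>
           (\<forall>t::real. t \<ge> t\<^sub>0 \<longrightarrow>
             cmod (mittag_leffler \<alpha> 1 (lam * of_real (t powr \<alpha>))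
                   - of_real (1 / \<alpha>) * exp (lam powr of_real (1 / \<alpha>) * of_real t))
             \<le> m / t powr \<alpha>))
       \<and> (\<bar>Arg lam\<bar> < \<alpha> * pi / 2 \<longrightarrow>
           (\<forall>t::real. t \<ge> t\<^sub>0 \<longrightarrow>
             cmod (of_real (t powr (\<alpha> - 1))
                     * mittag_leffler \<alpha> (of_real \<alpha>) (lam * of_real (t powr \<alpha>))
                   - of_real (1 / \<alpha>) * lam powr of_real (1 / \<alpha> - 1)
                     * exp (lam powr of_real (1 / \<alpha>) * of_real t))
             \<le> m / t powr (\<alpha> + 1)))
       \<and> (\<theta> < \<bar>Arg lam\<bar> \<and> \<bar>Arg lam\<bar> \<le> pi \<longrightarrow>
           (\<forall>t::real. t \<ge> t\<^sub>0 \<longrightarrow>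
             cmod (of_real (t powr (\<alpha> - 1))
                     * mittag_leffler \<alpha> (of_real \<alpha>) (lam * of_real (t powr \<alpha>)))
             \<le> m / t powr (\<alpha> + 1)))"
proof -
  define \<kappa> where "\<kappa> = 1 / \<alpha>"
  define s where "s = sin \<theta>\<^sub>0"
  define L where "L = cmod lam"
  have L: "L > 0" using assms(3) by (simp add: L_def)
  have \<alpha>: "\<alpha> = 1 / \<kappa>" using assms(1) by (simp add: \<kappa>_def)
  have ap: "\<alpha> * pi < pi" using assms(2) by simp
  have "0 < \<alpha> * pi" using assms(1) by simp
  have \<theta>: "0 < \<theta>" "\<theta> < pi" using assms(4,5) ap \<open>0 < \<alpha> * pi\<close> by linarith+
  have \<theta>\<^sub>0: "0 < \<theta>\<^sub>0" "\<theta>\<^sub>0 < pi / 2" "\<theta>\<^sub>0 \<le> \<theta>" using assms(4-7) ap \<open>0 < \<alpha> * pi\<close> by linarith+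
  have \<kappa>: "\<kappa> > 0" "pi / 2 < \<kappa> * \<theta>" "\<kappa> * \<theta> < pi"
    using assms(1,4,5) by (simp_all add: \<kappa>_def field_simps)
  have \<kappa>\<theta>: "\<kappa> * \<theta> \<le> pi" using \<kappa> by simp
  have s: "0 < s" "s < 1"
    using \<theta>\<^sub>0 sin_gt_zero[of \<theta>\<^sub>0] sin_monotone_2pi[of \<theta>\<^sub>0 "pi / 2"] by (auto simp: s_def)

  \<comment> \<open>V 0 and V \<kappa> are the two arc length integrals in m, transported to the
    variable w.\<close>
  define V where "V b = hankel_length_integral 0 \<theta> (\<lambda>w. norm (hankel_kernel \<kappa> b w) * norm (exp w))" for b
  have V_int: "hankel_integrable 0 \<theta> (\<lambda>w. norm (hankel_kernel \<kappa> b w) * norm (exp w))" for b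
    using hankel_integrable_norm_kernel_exp[OF \<kappa>(1,2) \<kappa>\<theta>, of 0 1 b] by simp
  have "arc_length_integral (hankel_contour 1 \<theta>) (\<lambda>\<zeta>. cmod (exp (\<zeta> powr of_real \<kappa>))) = V 0"
    using arc_length_integral_powr[OF \<theta>, of "\<lambda>u. cmod (exp u)" \<kappa>] V_int[of 0]
    by (simp add: V_def hankel_kernel_def continuous_intros del: norm_exp_eq_Re)
  moreover have "arc_length_integral (hankel_contour 1 \<theta>)
      (\<lambda>\<zeta>. cmod (exp (\<zeta> powr of_real \<kappa>) * \<zeta> powr of_real \<kappa>)) = V \<kappa>"
    using arc_length_integral_powr[OF \<theta>, of "\<lambda>u. cmod (exp u * u)" \<kappa>] V_int[of \<kappa>]
    by (simp add: V_def hankel_kernel_def continuous_intros del: norm_exp_eq_Re)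
  ultimately have m: "m = max (V 0 / (2 * \<alpha> * pi * L * s)) (V \<kappa> / (2 * \<alpha> * L\<^sup>2 * s))"
    unfolding m_eq \<kappa>_def[symmetric] s_def L_def by simp

  \<comment> \<open>All three claims are instances: in (i) and (ii), |Arg lam| < \<alpha>\<pi>/2 <
    \<theta>, so the residue is present, and (iii) is the case in which it is absent.\<close>
  have bounds: "(\<bar>Arg lam\<bar> < \<theta> \<longrightarrow>
      cmod (mittag_leffler \<alpha> 1 (lam * of_real (t powr \<alpha>))
        - of_real (1 / \<alpha>) * exp (lam powr of_real (1 / \<alpha>) * of_real t)) \<le> m / t powr \<alpha>) \<and>
     cmod (of_real (t powr (\<alpha> - 1)) * mittag_leffler \<alpha> (of_real \<alpha>) (lam * of_real (t powr \<alpha>))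
        - (if \<bar>Arg lam\<bar> < \<theta> then of_real (1 / \<alpha>) * lam powr of_real (1 / \<alpha> - 1)
             * exp (lam powr of_real (1 / \<alpha>) * of_real t) else 0)) \<le> m / t powr (\<alpha> + 1)"
    if t: "t \<ge> t\<^sub>0" for t
  proof -
    define z where "z = lam * of_real (t powr \<alpha>)"
    define T where "T = t powr \<alpha>"
    have "t\<^sub>0 > 0" unfolding t0_eq using L s by (simp add: L_def s_def)
    hence t0: "t > 0" using t by simp
    have T: "T > 0" using t0 by (simp add: T_def)
    have "t\<^sub>0 powr \<alpha> = 1 / (L * (1 - s))"
      unfolding t0_eq using L s assms(1)
      by (simp add: L_def[symmetric] s_def[symmetric] powr_divide powr_mult powr_powr)
    moreover have "t\<^sub>0 powr \<alpha> \<le> T"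
      unfolding T_def using t \<open>t\<^sub>0 > 0\<close> assms(1) by (intro powr_mono2) auto
    ultimately have "1 / (L * (1 - s)) \<le> T" by simp
    \<comment> \<open>The threshold \<open>t\<^sub>0\<close> is made for this inequality, the
      hypothesis of the distance estimate; together with s > 0 it also forces |z| > 1.\<close>
    hence LT: "L * T * (1 - s) \<ge> 1"
      using L s by (simp add: pos_divide_le_eq mult_ac)
    have nz: "cmod z = L * T" using T by (simp add: z_def L_def T_def norm_mult)
    have z0: "z \<noteq> 0" using nz L T by auto
    have "L * T * (1 - s) < L * T" using L T s by (simp add: algebra_simps)
    hence z1: "cmod z > 1" using LT nz by simp
    have Arg: "Arg z = Arg lam" using t0 by (simp add: z_def)
    have dist: "L * T * s \<le> norm (exp w - z)" if "w \<in> log_contour 0 \<theta>" for w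
      using norm_exp_diff_log_contour_ge[OF \<theta> \<theta>\<^sub>0, of z w] that assms(8) LT
      by (simp add: Arg nz s_def)
    have \<delta>: "L * T * s > 0" using L T s by simp
    have Argne: "\<bar>Arg z\<bar> \<noteq> \<theta>" using assms(8) \<theta>\<^sub>0 Arg by auto
    have Ln_z: "Ln z = Ln lam + of_real (\<alpha> * ln t)"
      using assms(3) t0 Ln_times_of_real[of "t powr \<alpha>" lam] Ln_of_real[of "t powr \<alpha>"]
      by (simp add: z_def mult.commute ln_powr add.commute)
    have zk: "exp (of_real \<kappa> * Ln z) = lam powr of_real (1 / \<alpha>) * of_real t"
    proof -
      have "of_real \<kappa> * Ln z = of_real (1 / \<alpha>) * Ln lam + of_real (ln t)"
        unfolding Ln_z \<kappa>_def using assms(1) by (simp add: algebra_simps)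
      thus ?thesis using assms(3) t0 by (simp add: exp_add powr_def exp_of_real)
    qed
    \<comment> \<open>The power t^(1-\<alpha>) contained in z^(\<kappa>-1) cancels the prefactor
      t^(\<alpha>-1).\<close>
    have zk1: "of_real (t powr (\<alpha> - 1)) * exp (of_real (\<kappa> - 1) * Ln z) = lam powr of_real (1 / \<alpha> - 1)"
    proof -
      have "of_real (\<kappa> - 1) * Ln z = of_real (1 / \<alpha> - 1) * Ln lam + of_real ((1 - \<alpha>) * ln t)"
        unfolding Ln_z \<kappa>_def using assms(1) by (simp add: field_simps)
      hence "exp (of_real (\<kappa> - 1) * Ln z) = lam powr of_real (1 / \<alpha> - 1) * of_real (exp ((1 - \<alpha>) * ln t))"
        using assms(3) by (simp only: exp_add exp_of_real) (simp add: powr_def)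
      moreover have "t powr (\<alpha> - 1) * exp ((1 - \<alpha>) * ln t) = 1"
        using t0 by (simp add: powr_def mult_exp_exp algebra_simps)
      hence "complex_of_real (t powr (\<alpha> - 1)) * of_real (exp ((1 - \<alpha>) * ln t)) = 1"
        by (simp only: of_real_mult[symmetric] of_real_1)
      ultimately show ?thesis
        by (simp only: mult.left_commute[of "complex_of_real (t powr (\<alpha> - 1))"] mult_1_right)
    qed
    have rep: "mittag_leffler \<alpha> (of_real (1 - b / \<kappa>)) z
        - (if \<bar>Arg lam\<bar> < \<theta> then \<kappa> * hankel_kernel \<kappa> b (Ln z) else 0)
      = \<kappa> / (2 * pi * \<i>) * hankel_integral 0 \<theta> (ml_kernel \<kappa> b z)" for b
    proof -
      have "hankel_integrable 0 \<theta> (ml_kernel \<kappa> b z)"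
        by (rule hankel_integrable_ml_kernel[OF \<kappa>(1,2) \<kappa>\<theta> \<delta>]) (rule dist)
      from mittag_leffler_hankel_integral[OF \<kappa> \<theta>(2) z1 Argne this] show ?thesis
        unfolding \<alpha> by (simp add: Arg)
    qed
    have U: "norm (hankel_integral 0 \<theta> (ml_kernel \<kappa> b z)) \<le> V b / (L * T * s)" for b
      unfolding V_def by (rule norm_hankel_integral_ml_kernel_le[OF \<kappa>(1,2) \<kappa>\<theta> \<delta>]) (rule dist)
    have nk: "norm (\<kappa> / (2 * pi * \<i>) :: complex) = \<kappa> / (2 * pi)"
      using \<kappa>(1) by (simp add: norm_divide norm_mult)

    have "cmod (mittag_leffler \<alpha> 1 z - of_real (1 / \<alpha>) * exp (lam powr of_real (1 / \<alpha>) * of_real t)) \<le> m / T"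
      if "\<bar>Arg lam\<bar> < \<theta>"
    proof -
      have "mittag_leffler \<alpha> 1 z - of_real (1 / \<alpha>) * exp (lam powr of_real (1 / \<alpha>) * of_real t)
          = \<kappa> / (2 * pi * \<i>) * hankel_integral 0 \<theta> (ml_kernel \<kappa> 0 z)"
        using rep[of 0] that unfolding hankel_kernel_def zk by (simp add: \<kappa>_def)
      also have "norm \<dots> \<le> \<kappa> / (2 * pi) * (V 0 / (L * T * s))"
        unfolding norm_mult nk using \<kappa>(1) by (intro mult_left_mono U) auto
      also have "\<dots> = V 0 / (2 * \<alpha> * pi * L * s) / T" by (simp add: \<kappa>_def field_simps)
      also have "\<dots> \<le> m / T" using T unfolding m by (intro divide_right_mono) auto
      finally show ?thesis .
    qed
    moreover have "cmod (of_real (t powr (\<alpha> - 1)) * mittag_leffler \<alpha> (of_real \<alpha>) z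
        - (if \<bar>Arg lam\<bar> < \<theta> then of_real (1 / \<alpha>) * lam powr of_real (1 / \<alpha> - 1)
             * exp (lam powr of_real (1 / \<alpha>) * of_real t) else 0)) \<le> m / t powr (\<alpha> + 1)"
    proof -
      have "1 - (\<kappa> - 1) / \<kappa> = \<alpha>" using assms(1) by (simp add: \<kappa>_def field_simps)
      moreover have "hankel_integral 0 \<theta> (ml_kernel \<kappa> (\<kappa> - 1) z) = hankel_integral 0 \<theta> (ml_kernel \<kappa> \<kappa> z) / z"
        by (rule hankel_integral_ml_kernel_kappa_minus_1[OF \<kappa> z0 \<delta>]) (rule dist)
      ultimately have rep': "mittag_leffler \<alpha> (of_real \<alpha>) z
          - (if \<bar>Arg lam\<bar> < \<theta> then \<kappa> * hankel_kernel \<kappa> (\<kappa> - 1) (Ln z) else 0)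
        = \<kappa> / (2 * pi * \<i>) * (hankel_integral 0 \<theta> (ml_kernel \<kappa> \<kappa> z) / z)"
        using rep[of "\<kappa> - 1"] by (simp only:)
      have K: "of_real (t powr (\<alpha> - 1)) * (of_real \<kappa> * hankel_kernel \<kappa> (\<kappa> - 1) (Ln z))
          = of_real (1 / \<alpha>) * lam powr of_real (1 / \<alpha> - 1) * exp (lam powr of_real (1 / \<alpha>) * of_real t)"
        unfolding hankel_kernel_def zk zk1[symmetric] by (simp add: \<kappa>_def mult_ac)
      have "of_real (t powr (\<alpha> - 1)) * mittag_leffler \<alpha> (of_real \<alpha>) z
        - (if \<bar>Arg lam\<bar> < \<theta> then of_real (1 / \<alpha>) * lam powr of_real (1 / \<alpha> - 1)
             * exp (lam powr of_real (1 / \<alpha>) * of_real t) else 0)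
        = of_real (t powr (\<alpha> - 1)) * (\<kappa> / (2 * pi * \<i>) * (hankel_integral 0 \<theta> (ml_kernel \<kappa> \<kappa> z) / z))"
        unfolding rep'[symmetric] right_diff_distrib K[symmetric] by simp
      also have "norm \<dots> = t powr (\<alpha> - 1) * (\<kappa> / (2 * pi) * (norm (hankel_integral 0 \<theta> (ml_kernel \<kappa> \<kappa> z)) / (L * T)))"
        unfolding norm_mult norm_divide[of _ z] nk nz using t0 by simp
      also have "\<dots> \<le> t powr (\<alpha> - 1) * (\<kappa> / (2 * pi) * (V \<kappa> / (L * T * s) / (L * T)))"
        using \<kappa>(1) L T by (intro mult_left_mono divide_right_mono U) auto
      also have "\<dots> = V \<kappa> / (2 * \<alpha> * L\<^sup>2 * s) / pi * (t powr (\<alpha> - 1) / T\<^sup>2)"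
        using assms(1) by (simp add: \<kappa>_def field_simps power2_eq_square)
      \<comment> \<open>Here T squared is t^(2\<alpha>): one factor T comes from the distance bound,
        the other from 1/z.\<close>
      also have "t powr (\<alpha> - 1) / T\<^sup>2 = 1 / t powr (\<alpha> + 1)"
        using t0 by (simp add: T_def power2_eq_square powr_diff powr_add field_simps)
      \<comment> \<open>The estimate carries an additional 1/\<pi> compared with the second entry of
        m. Dropping it enlarges the bound because V \<kappa> is nonnegative, which U shows.\<close>
      also have "V \<kappa> / (2 * \<alpha> * L\<^sup>2 * s) / pi * (1 / t powr (\<alpha> + 1)) \<le> m * (1 / t powr (\<alpha> + 1))"
      proof (intro mult_right_mono)
        have "0 \<le> V \<kappa> / (L * T * s)" using U[of \<kappa>] norm_ge_zero order.trans by blast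
        hence "V \<kappa> \<ge> 0" using \<delta> by (simp add: zero_le_divide_iff)
        hence "V \<kappa> / (2 * \<alpha> * L\<^sup>2 * s) \<ge> 0" using assms(1) s by simp
        hence "V \<kappa> / (2 * \<alpha> * L\<^sup>2 * s) / pi \<le> V \<kappa> / (2 * \<alpha> * L\<^sup>2 * s) / 1"
          using pi_gt3 by (intro divide_left_mono) auto
        also have "\<dots> \<le> m" unfolding m by simp
        finally show "V \<kappa> / (2 * \<alpha> * L\<^sup>2 * s) / pi \<le> m" .
      qed simp
      finally show ?thesis by simp
    qed
    ultimately show ?thesis unfolding z_def T_def by blast
  qed
  have lt: "\<bar>Arg lam\<bar> < \<theta>" if "\<bar>Arg lam\<bar> < \<alpha> * pi / 2" using that assms(4) by linarith
  show ?thesis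
  proof (intro conjI impI allI)
    fix t assume "\<bar>Arg lam\<bar> < \<alpha> * pi / 2" "t \<ge> t\<^sub>0"
    thus "cmod (mittag_leffler \<alpha> 1 (lam * of_real (t powr \<alpha>))
        - of_real (1 / \<alpha>) * exp (lam powr of_real (1 / \<alpha>) * of_real t)) \<le> m / t powr \<alpha>"
      using bounds lt by blast
  next
    fix t assume "\<bar>Arg lam\<bar> < \<alpha> * pi / 2" "t \<ge> t\<^sub>0"
    thus "cmod (of_real (t powr (\<alpha> - 1)) * mittag_leffler \<alpha> (of_real \<alpha>) (lam * of_real (t powr \<alpha>))
        - of_real (1 / \<alpha>) * lam powr of_real (1 / \<alpha> - 1) * exp (lam powr of_real (1 / \<alpha>) * of_real t))
        \<le> m / t powr (\<alpha> + 1)"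
      using conjunct2[OF bounds[of t]] lt by simp
  next
    fix t assume "\<theta> < \<bar>Arg lam\<bar> \<and> \<bar>Arg lam\<bar> \<le> pi" "t \<ge> t\<^sub>0"
    thus "cmod (of_real (t powr (\<alpha> - 1)) * mittag_leffler \<alpha> (of_real \<alpha>) (lam * of_real (t powr \<alpha>)))
        \<le> m / t powr (\<alpha> + 1)"
      using conjunct2[OF bounds[of t]] by simp
  qed
qed

end
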